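(* Let $\eta,\theta>0$ and $\alpha\in(0,1]$. Then the function $$\varphi_\theta(\eta):=\alpha\gamma(\alpha;\eta+\theta)-\alpha\gamma(\alpha;\theta)$$ is the Laplace exponent of a (tempered) subordinator $S_{\alpha,\theta}:=\{S_{\alpha,\theta}(t),t\ge0\}$, with Lévy triplet $(0,0,\pi_\theta)$ and (absolutely continuous) Lévy measure $\pi_\theta$, with density $$\overline{\pi}_\theta(z)=\frac{1_{z\ge 1}\,\alpha(z-1)^{-\alpha}z^{-1}e^{-\theta z}}{\Gamma(1-\alpha)}.$$ The sample paths of $S_{\alpha,\theta}$ are not strictly increasing; the mean and variance of $S_{\alpha,\theta}$ read, respectively, $$\mathbb{E}S_{\alpha,\theta}(t)=t\,\alpha\theta^{\alpha-1}e^{-\theta},\qquad \mathrm{Var}\,S_{\alpha,\theta}(t)=t\,\alpha\theta^{\alpha-1}e^{-\theta}+\alpha(1-\alpha)\,t\,\theta^{\alpha-2}e^{-\theta}.$$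
   Context: $\gamma(\alpha;x)=\int_0^x e^{-w}w^{\alpha-1}\,dw$ is the lower-incomplete gamma function. A subordinator is a Lévy process $S$ with non-decreasing paths; its Laplace exponent $\varphi$ is defined by $\mathbb{E}e^{-\eta S(t)}=e^{-t\varphi(\eta)}$. The Lévy triplet $(a,b,\nu)$ of a Bernstein function $\varphi$ is the one in the representation $\varphi(\eta)=a+b\eta+\int_0^{\infty}(1-e^{-s\eta})\,\nu(ds)$, with $a,b\ge 0$ and $\nu$ (the Lévy measure) a measure on $(0,\infty)$ with $\int_0^\infty (s\wedge 1)\,\nu(ds)<\infty$. Absolute continuity and density are with respect to Lebesgue measure.
   Formalization: Absolute continuity and the density of the Lévy measure are proved for α<1 only; at α=1 the displayed density vanishes (1/Γ(0)=0) while φ_θ(η)=e^{-θ}(1-e^{-η}) does not, so there the Lévy measure is stated to be the atom e^{-θ}δ_1. *)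

theory Defs
  imports "HOL-Probability.Probability"
begin

definition lower_gamma :: "real \<Rightarrow> real \<Rightarrow> real" where
  "lower_gamma \<alpha> x = (LINT w:{0..x}|lborel. exp (- w) * w powr (\<alpha> - 1))"

text \<open>Paths are indexed by \<open>real\<close>, but only times \<open>t \<ge> 0\<close> are constrained.
  The increments are taken along arbitrary grids \<open>0 \<le> t 0 \<le> \<dots> \<le> t n\<close>.\<close>

definition independent_increments :: "'w measure \<Rightarrow> (real \<Rightarrow> 'w \<Rightarrow> real) \<Rightarrow> bool" where
  "independent_increments M X \<longleftrightarrow>
     (\<forall>n (t :: nat \<Rightarrow> real). 0 \<le> t 0 \<and> mono_on {..n} t \<longrightarrow>
        prob_space.indep_vars M (\<lambda>_. borel)
          (\<lambda>i \<omega>. X (t (Suc i)) \<omega> - X (t i) \<omega>) {..<n})"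

definition stationary_increments :: "'w measure \<Rightarrow> (real \<Rightarrow> 'w \<Rightarrow> real) \<Rightarrow> bool" where
  "stationary_increments M X \<longleftrightarrow>
     (\<forall>s\<ge>0. \<forall>t\<ge>0. distr M borel (\<lambda>\<omega>. X (s + t) \<omega> - X s \<omega>) =
                 distr M borel (\<lambda>\<omega>. X t \<omega> - X 0 \<omega>))"

definition stochastically_continuous :: "'w measure \<Rightarrow> (real \<Rightarrow> 'w \<Rightarrow> real) \<Rightarrow> bool" where
  "stochastically_continuous M X \<longleftrightarrow>
     (\<forall>t\<ge>0. \<forall>\<epsilon>>0.
        ((\<lambda>s. measure M {\<omega> \<in> space M. \<bar>X s \<omega> - X t \<omega>\<bar> > \<epsilon>}) \<longlongrightarrow> 0) (at t within {0..}))"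

definition cadlag_path :: "(real \<Rightarrow> real) \<Rightarrow> bool" where
  "cadlag_path f \<longleftrightarrow>
     (\<forall>t\<ge>0. (f \<longlongrightarrow> f t) (at_right t)) \<and> (\<forall>t>0. \<exists>l. (f \<longlongrightarrow> l) (at_left t))"

definition levy_process :: "'w measure \<Rightarrow> (real \<Rightarrow> 'w \<Rightarrow> real) \<Rightarrow> bool" where
  "levy_process M X \<longleftrightarrow>
     prob_space M \<and>
     (\<forall>t\<ge>0. X t \<in> borel_measurable M) \<and>
     (AE \<omega> in M. X 0 \<omega> = 0) \<and>
     independent_increments M X \<and>
     stationary_increments M X \<and>
     stochastically_continuous M X \<and>
     (AE \<omega> in M. cadlag_path (\<lambda>t. X t \<omega>))"

definition subordinator :: "'w measure \<Rightarrow> (real \<Rightarrow> 'w \<Rightarrow> real) \<Rightarrow> bool" where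
  "subordinator M S \<longleftrightarrow> levy_process M S \<and> (AE \<omega> in M. mono_on {0..} (\<lambda>t. S t \<omega>))"

definition has_laplace_exponent ::
    "'w measure \<Rightarrow> (real \<Rightarrow> 'w \<Rightarrow> real) \<Rightarrow> (real \<Rightarrow> real) \<Rightarrow> bool" where
  "has_laplace_exponent M S \<phi> \<longleftrightarrow>
     (\<forall>t\<ge>0. \<forall>\<eta>>0. (LINT \<omega>|M. exp (- \<eta> * S t \<omega>)) = exp (- t * \<phi> \<eta>))"

text \<open>A measure on \<open>(0,\<infinity>)\<close> is represented by a Borel measure on the real line
  that gives no mass to \<open>(-\<infinity>,0]\<close>.\<close>

definition levy_measure :: "real measure \<Rightarrow> bool" where
  "levy_measure \<nu> \<longleftrightarrow>
     sets \<nu> = sets borel \<and> emeasure \<nu> {..0} = 0 \<and> (\<integral>\<^sup>+ s. ennreal (min s 1) \<partial>\<nu>) < \<infinity>"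

definition levy_triplet :: "(real \<Rightarrow> real) \<Rightarrow> real \<Rightarrow> real \<Rightarrow> real measure \<Rightarrow> bool" where
  "levy_triplet \<phi> a b \<nu> \<longleftrightarrow>
     0 \<le> a \<and> 0 \<le> b \<and> levy_measure \<nu> \<and>
     (\<forall>\<eta>>0. \<phi> \<eta> = a + b * \<eta> + (LINT s|\<nu>. 1 - exp (- s * \<eta>)))"

definition phi_tempered :: "real \<Rightarrow> real \<Rightarrow> real \<Rightarrow> real" where
  "phi_tempered \<alpha> \<theta> \<eta> = \<alpha> * lower_gamma \<alpha> (\<eta> + \<theta>) - \<alpha> * lower_gamma \<alpha> \<theta>"

text \<open>For \<open>\<alpha> = 1\<close> the factor \<open>1 / \<Gamma>(1 - \<alpha>)\<close> vanishes (classically because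
  \<open>\<Gamma>\<close> has a pole at \<open>0\<close>; here because \<open>Gamma 0 = 0\<close> and \<open>x / 0 = 0\<close>), so this is
  the density of a Levy measure only for \<open>\<alpha> < 1\<close>.\<close>

definition pi_density :: "real \<Rightarrow> real \<Rightarrow> real \<Rightarrow> real" where
  "pi_density \<alpha> \<theta> z =
     indicator {1..} z * \<alpha> * (z - 1) powr (- \<alpha>) * z powr (- 1) * exp (- \<theta> * z) / Gamma (1 - \<alpha>)"

end

theory Submission
  imports Defs
begin

text \<open>The Levy measure \<open>\<pi>\<close> lives on \<open>[1, \<infinity>)\<close> and is finite, so the subordinator is a compound Poisson
  process.  It is built from independent blocks, one for each unit time interval, carrying a Poisson
  number of uniformly placed jumps with law \<open>\<pi>\<close> normalised.  Its joint Laplace transform over a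
  time grid factorises, and since Laplace transforms determine measures on the half line
  (Weierstrass approximation in \<open>exp (- x)\<close>), this gives independent and stationary increments.

  The exponent is identified with the integral against \<open>\<pi>\<close> by Tonelli and the Gamma integral.
  For an arbitrary process with this exponent, mean and second moment are the monotone limits of
  the expectations of \<open>(1 - exp (- h X)) / h\<close> and of its square along \<open>h = 2\<^sup>-\<^sup>n\<close>.  Paths are not strictly
  increasing because the exponent is bounded: \<open>S t = 0\<close> with probability tending to \<open>1\<close> as
  \<open>t\<close> tends to \<open>0\<close>.\<close>

subsection \<open>Laplace transforms on the half line\<close>

text \<open>The density comes from differentiating the exponent: \<open>phi_tempered\<close> has
  derivative \<alpha> exp(-w) w^(\<alpha> - 1) with w = \<eta> + \<theta>, the Laplace transform at
  w of \<alpha> (z - 1)^(-\<alpha>) / Gamma(1 - \<alpha>) on z \<ge> 1. The factor exp(-w) is a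
  shift by 1, hence jumps of size at least 1; integrating in \<eta> contributes 1/z, and \<theta>
  contributes exp(-\<theta> z). At \<alpha> = 1 only the shift is left and all jumps have size 1, so
  the construction is made for finite jump measures that need not have a density. The obstacle is
  independence of increments: given the number of jumps in a block, the numbers falling into
  different grid intervals are dependent. Thinning of Poisson counts is avoided. A single jump falls
  into at most one grid interval, so its factor in the joint transform is affine in the terms 1 -
  exp(-u_i y); the Poisson generating function sends the mean of that factor to the exponential of a
  sum, that is, to a product over the grid. The claims about every process with this exponent use
  neither the construction nor uniqueness in law.\<close>

lemma finite_measure_eqI_laplace:
  fixes \<mu> \<nu> :: "real measure"
  assumes fin: "finite_measure \<mu>" "finite_measure \<nu>"
    and sets: "sets \<mu> = sets borel" "sets \<nu> = sets borel"
    and nonneg: "AE x in \<mu>. 0 \<le> x" "AE x in \<nu>. 0 \<le> x"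
    and eq: "\<And>n::nat. (LINT x|\<mu>. exp (- real n * x)) = (LINT x|\<nu>. exp (- real n * x))"
  shows "\<mu> = \<nu>"
proof -
  \<comment> \<open>Truncation at 1 puts the values into [0,1] for negative x too, so approximation
    on [0,1] is uniform on the whole line. Under both measures \<open>c x\<close> is almost
    everywhere \<open>exp (- x)\<close>, and its powers are the Laplace kernels at the
    integers.\<close>
  define c :: "real \<Rightarrow> real" where "c x = min 1 (exp (- x))" for x
  have c01: "c x \<in> {0..1}" for x by (auto simp: c_def)
  have bint: "integrable M g"
    if "finite_measure M" "sets M = sets borel" "g \<in> borel_measurable borel" "\<And>x. \<bar>g x\<bar> \<le> B"
    for M :: "real measure" and g :: "real \<Rightarrow> real" and B
  proof -
    have [measurable]: "g \<in> borel_measurable M"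
      using that(2,3) by (simp cong: measurable_cong_sets)
    show ?thesis
      by (rule finite_measure.integrable_const_bound[OF that(1), of _ B])
         (use that in \<open>auto simp: real_norm_def\<close>)
  qed
  have [measurable]: "c \<in> borel_measurable borel" unfolding c_def by measurable
  have pow: "(LINT x|M. c x ^ n) = (LINT x|M. exp (- real n * x))"
    if "sets M = sets borel" "AE x in M. 0 \<le> x" for M :: "real measure" and n
  proof (rule integral_cong_AE)
    show "AE x in M. c x ^ n = exp (- real n * x)"
      using that(2) by eventually_elim (auto simp: c_def exp_of_nat_mult[symmetric] min_def)
  qed (use that in \<open>simp_all cong: measurable_cong_sets\<close>)
  have poly_eq: "(LINT x|\<mu>. p (c x)) = (LINT x|\<nu>. p (c x))" if p: "real_polynomial_function p" for p
  proof -
    obtain a n where a: "p = (\<lambda>x. \<Sum>i\<le>n. a i * x ^ i)"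
      using p by (auto simp: real_polynomial_function_iff_sum)
    have i: "integrable M (\<lambda>x. c x ^ i)" if "finite_measure M" "sets M = sets borel"
      for M :: "real measure" and i
      by (intro bint[OF that, of _ 1])
         (use c01 in \<open>auto simp: power_abs intro!: power_le_one\<close>)
    show ?thesis
      unfolding a using pow[OF sets(1) nonneg(1)] pow[OF sets(2) nonneg(2)] eq
      by (subst (1 2) Bochner_Integration.integral_sum) (auto simp: i fin sets)
  qed
  have cont_eq: "(LINT x|\<mu>. f (c x)) = (LINT x|\<nu>. f (c x))"
    if f: "continuous_on UNIV f" for f :: "real \<Rightarrow> real"
  proof -
    \<comment> \<open>A uniform error \<open>e / K\<close> integrates to at most \<open>e\<close>
      over both measures together; the summand 1 keeps \<open>K\<close> positive when both are
      zero.\<close>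
    define K where "K = measure \<mu> (space \<mu>) + measure \<nu> (space \<nu>) + 1"
    have K: "K > 0" by (auto simp: K_def intro!: add_nonneg_pos)
    have "compact (f ` {0..1})" by (intro compact_continuous_image continuous_on_subset[OF f]) auto
    then obtain Bf where Bf: "\<And>x. x \<in> {0..1} \<Longrightarrow> \<bar>f x\<bar> \<le> Bf"
      by (meson compact_imp_bounded bounded_real imageI)
    have [measurable]: "f \<in> borel_measurable borel"
      using f by (rule borel_measurable_continuous_onI)
    have "\<bar>(LINT x|\<mu>. f (c x)) - (LINT x|\<nu>. f (c x))\<bar> \<le> e" if "e > 0" for e
    proof -
      have "e / K > 0" using that K by simp
      then obtain p where p: "real_polynomial_function p"
        and pe: "\<And>x. x \<in> {0..1} \<Longrightarrow> \<bar>f x - p x\<bar> < e / K"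
        by (rule Stone_Weierstrass_real_polynomial_function[where S = "{0..1::real}" and f = f, rotated 2])
           (auto intro: continuous_on_subset[OF f])
      have [measurable]: "p \<in> borel_measurable borel"
        using p by (intro borel_measurable_continuous_onI continuous_on_polymonial_function)
          (simp add: real_polynomial_function_eq)
      have fi: "integrable M (\<lambda>x. f (c x))" if "finite_measure M" "sets M = sets borel"
        for M :: "real measure"
        by (rule bint[OF that, of _ Bf]) (use Bf c01 in auto)
      have pb: "\<bar>p (c x)\<bar> \<le> Bf + e / K" for x
        using pe[OF c01, of x] Bf[OF c01, of x] by linarith
      have pi: "integrable M (\<lambda>x. p (c x))" if "finite_measure M" "sets M = sets borel"
        for M :: "real measure"
        by (rule bint[OF that, of _ "Bf + e / K"]) (use pb in auto)
      have d: "\<bar>(LINT x|M. f (c x)) - (LINT x|M. p (c x))\<bar> \<le> e / K * measure M (space M)"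
        if M: "finite_measure M" "sets M = sets borel" for M :: "real measure"
      proof -
        have "\<bar>(LINT x|M. f (c x)) - (LINT x|M. p (c x))\<bar> = \<bar>LINT x|M. f (c x) - p (c x)\<bar>"
          by (simp add: fi pi M)
        also have "\<dots> \<le> (LINT x|M. \<bar>f (c x) - p (c x)\<bar>)" by (rule integral_abs_bound)
        also have "\<dots> \<le> (LINT x|M. e / K)"
          using M pe[OF c01] by (intro integral_mono) (auto intro!: fi pi less_imp_le finite_measure.integrable_const)
        finally show ?thesis by (simp add: mult.commute)
      qed
      have "\<bar>(LINT x|\<mu>. f (c x)) - (LINT x|\<nu>. f (c x))\<bar> \<le>
         e / K * measure \<mu> (space \<mu>) + e / K * measure \<nu> (space \<nu>)"
        using d[OF fin(1) sets(1)] d[OF fin(2) sets(2)] poly_eq[OF p] by linarith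
      also have "\<dots> \<le> e / K * K"
        using \<open>e / K > 0\<close> by (subst distrib_left[symmetric], intro mult_left_mono) (auto simp: K_def)
      also have "\<dots> = e" using K by simp
      finally show ?thesis .
    qed
    then show ?thesis using field_le_epsilon[of "\<bar>(LINT x|\<mu>. f (c x)) - (LINT x|\<nu>. f (c x))\<bar>" 0]
      by auto
  qed
  \<comment> \<open>The indicator of \<open>{..a}\<close> is a limit of ramps that are continuous in
    \<open>c x\<close>: for x \<ge> 0 the ramp is 1 exactly when x \<le> a and otherwise is 0 for
    all large m. So \<open>cont_eq\<close> reaches the distribution function.\<close>
  have cdf_lim: "(\<lambda>m. LINT x|M. max 0 (min 1 (1 - real m * (exp (- a) - c x)))) \<longlonglongrightarrow> measure M {..a}"
    if M: "finite_measure M" "sets M = sets borel" and pos: "AE x in M. 0 \<le> x" and "0 \<le> a"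
    for M :: "real measure" and a
  proof -
    have sp: "space M = UNIV" using sets_eq_imp_space_eq[OF M(2)] by simp
    have [measurable_cong]: "sets M = sets borel" by fact
    have "(\<lambda>m. LINT x|M. max 0 (min 1 (1 - real m * (exp (- a) - c x)))) \<longlonglongrightarrow> (LINT x|M. indicator {..a} x)"
    proof (rule integral_dominated_convergence[where w = "\<lambda>_. 1"])
      show "AE x in M. (\<lambda>m. max 0 (min 1 (1 - real m * (exp (- a) - c x)))) \<longlonglongrightarrow> indicator {..a} x"
        using pos
      proof eventually_elim
        fix x :: real assume "0 \<le> x"
        then have cx: "c x = exp (- x)" by (auto simp: c_def)
        show "(\<lambda>m. max 0 (min 1 (1 - real m * (exp (- a) - c x)))) \<longlonglongrightarrow> indicator {..a} x"
        proof (cases "x \<le> a")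
          case True
          then have "max 0 (min 1 (1 - real m * (exp (- a) - c x))) = 1" for m
            using cx by (auto simp: max_def min_def mult_le_0_iff)
          with True show ?thesis by simp
        next
          case False
          then have d: "exp (- a) - c x > 0" using cx by simp
          have "eventually (\<lambda>m. max 0 (min 1 (1 - real m * (exp (- a) - c x))) = 0) sequentially"
          proof -
            obtain m0 where m0: "1 < real m0 * (exp (- a) - c x)" using d reals_Archimedean3 by blast
            show ?thesis unfolding eventually_sequentially
            proof (intro exI[of _ m0] allI impI)
              fix m assume "m0 \<le> m"
              then have "real m0 * (exp (- a) - c x) \<le> real m * (exp (- a) - c x)"
                using d by (intro mult_right_mono) auto
              then show "max 0 (min 1 (1 - real m * (exp (- a) - c x))) = 0" using m0 by linarith
            qed
          qed
          with False show ?thesis by (simp add: tendsto_eventually)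
        qed
      qed
      show "integrable M (\<lambda>_. 1::real)" by (rule finite_measure.integrable_const[OF M(1)])
      show "AE x in M. norm (max 0 (min 1 (1 - real m * (exp (- a) - c x)))) \<le> 1" for m
        by (auto intro!: AE_I2)
    qed measurable
    then show ?thesis by (simp add: sp)
  qed
  have meq: "measure \<mu> {..a} = measure \<nu> {..a}" for a
  proof (cases "0 \<le> a")
    case True
    have "(LINT x|\<mu>. max 0 (min 1 (1 - real m * (exp (- a) - c x)))) =
          (LINT x|\<nu>. max 0 (min 1 (1 - real m * (exp (- a) - c x))))" for m
      by (rule cont_eq) (intro continuous_intros)
    then show ?thesis
      using LIMSEQ_unique[OF cdf_lim[OF fin(1) sets(1) nonneg(1) True]] cdf_lim[OF fin(2) sets(2) nonneg(2) True]
      by auto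
  next
    case False
    have "measure M {..a} = 0" if "sets M = sets borel" "AE x in M. 0 \<le> x" for M :: "real measure"
    proof -
      have "AE x in M. x \<notin> {..a}" using that(2) False by (auto elim!: eventually_mono)
      then have "emeasure M {..a} = 0"
        using that(1) by (subst (asm) AE_iff_measurable[where N = "{..a}"])
          (auto simp: sets_eq_imp_space_eq[OF that(1)])
      then show ?thesis by (simp add: measure_def)
    qed
    then show ?thesis using sets nonneg by simp
  qed
  have fb: "finite_borel_measure M" if "finite_measure M" "sets M = sets borel" for M :: "real measure"
    using that by (auto simp: finite_borel_measure_def finite_borel_measure_axioms_def)
  show ?thesis
    by (rule cdf_unique'[OF fb[OF fin(1) sets(1)] fb[OF fin(2) sets(2)]]) (auto simp: cdf_def meq)
qed

text \<open>The images under \<open>X\<close> of \<open>M\<close> weighted by \<open>V\<close> and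
  by \<open>W\<close> have equal Laplace transforms at the integers. They need not have mass 1,
  which is why uniqueness is stated for finite measures.\<close>

lemma (in prob_space) weighted_laplace_unique:
  fixes X :: "'a \<Rightarrow> real"
  assumes [measurable]: "random_variable borel X" and X0: "AE \<omega> in M. 0 \<le> X \<omega>"
    and V: "integrable M V" "\<And>\<omega>. 0 \<le> V \<omega>" and W: "integrable M W" "\<And>\<omega>. 0 \<le> W \<omega>"
    and eq: "\<And>n::nat. expectation (\<lambda>\<omega>. V \<omega> * exp (- real n * X \<omega>)) =
               expectation (\<lambda>\<omega>. W \<omega> * exp (- real n * X \<omega>))"
    and [measurable]: "A \<in> sets borel"
  shows "expectation (\<lambda>\<omega>. V \<omega> * indicator A (X \<omega>)) = expectation (\<lambda>\<omega>. W \<omega> * indicator A (X \<omega>))"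
proof -
  define L where "L U = distr (density M (\<lambda>\<omega>. ennreal (U \<omega>))) borel X" for U :: "'a \<Rightarrow> real"
  have int: "(LINT x|L U. f x) = expectation (\<lambda>\<omega>. U \<omega> * f (X \<omega>))"
    if "integrable M U" "\<And>\<omega>. 0 \<le> U \<omega>" and [measurable]: "f \<in> borel_measurable borel"
    for U :: "'a \<Rightarrow> real" and f :: "real \<Rightarrow> real"
  proof -
    have [measurable]: "U \<in> borel_measurable M" using that by auto
    show ?thesis unfolding L_def using that(2)
      by (subst integral_distr, simp, simp, subst integral_density) auto
  qed
  have fin: "finite_measure (L U)" if "integrable M U" "\<And>\<omega>. 0 \<le> U \<omega>" for U :: "'a \<Rightarrow> real"
  proof -
    have [measurable]: "U \<in> borel_measurable M" using that by auto
    have "emeasure (density M (\<lambda>\<omega>. ennreal (U \<omega>))) (space M) = ennreal (expectation U)"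
      using that by (subst emeasure_density) (auto simp: nn_integral_eq_integral cong: nn_integral_cong)
    then show ?thesis unfolding L_def
      by (intro finite_measure.finite_measure_distr finite_measureI) auto
  qed
  have nonneg: "AE x in L U. 0 \<le> x" if "integrable M U" for U :: "'a \<Rightarrow> real"
  proof -
    have [measurable]: "U \<in> borel_measurable M" using that by auto
    show ?thesis using X0 unfolding L_def by (subst AE_distr_iff) (auto simp: AE_density)
  qed
  have "L V = L W"
  proof (rule finite_measure_eqI_laplace)
    show "(LINT x|L V. exp (- real n * x)) = (LINT x|L W. exp (- real n * x))" for n
      using eq[of n] by (simp add: int V W)
  qed (use V W in \<open>auto simp: fin nonneg L_def[THEN arg_cong[where f = sets]]\<close>)
  then show ?thesis using int[OF V, of "indicator A"] int[OF W, of "indicator A"] by simp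
qed

lemma (in prob_space) distr_eqI_laplace:
  fixes X Y :: "'a \<Rightarrow> real"
  assumes [measurable]: "random_variable borel X" "random_variable borel Y"
    and "AE \<omega> in M. 0 \<le> X \<omega>" "AE \<omega> in M. 0 \<le> Y \<omega>"
    and "\<And>n::nat. expectation (\<lambda>\<omega>. exp (- real n * X \<omega>)) = expectation (\<lambda>\<omega>. exp (- real n * Y \<omega>))"
  shows "distr M borel X = distr M borel Y"
  using assms
  by (intro finite_measure_eqI_laplace finite_measure_distr)
     (auto simp: AE_distr_iff integral_distr)

text \<open>The exponential weights are replaced by indicators one index at a time; the remaining factors
  serve as a weight for the one-dimensional uniqueness statement.\<close>

lemma (in prob_space) indep_vars_laplace:
  fixes X :: "'i \<Rightarrow> 'a \<Rightarrow> real"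
  assumes I: "finite I"
    and rv[measurable]: "\<And>i. i \<in> I \<Longrightarrow> random_variable borel (X i)"
    and X0: "\<And>i. i \<in> I \<Longrightarrow> AE \<omega> in M. 0 \<le> X i \<omega>"
    and eq: "\<And>u. (\<And>i. i \<in> I \<Longrightarrow> 0 \<le> u i) \<Longrightarrow>
      expectation (\<lambda>\<omega>. \<Prod>i\<in>I. exp (- u i * X i \<omega>)) = (\<Prod>i\<in>I. expectation (\<lambda>\<omega>. exp (- u i * X i \<omega>)))"
  shows "indep_vars (\<lambda>_. borel) X I"
proof (cases "I = {}")
  case True
  then show ?thesis by (auto simp: indep_vars_def indep_sets_def)
next
  case False
  \<comment> \<open>\<open>J\<close> holds the indices already switched from exponential to
    indicator. As above, \<open>min 1\<close> bounds the factors everywhere and changes them only on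
    a null set.\<close>
  define E where "E J u A i x = (if i \<in> J then indicator (A i) x else min 1 (exp (- u i * x)))"
    for J :: "'i set" and u :: "'i \<Rightarrow> real" and A and i and x :: real
  have E01: "0 \<le> E J u A i x" "E J u A i x \<le> 1" for J u A i x by (auto simp: E_def indicator_def)
  have E_meas[measurable]: "E J u A i \<in> borel_measurable borel" if "A i \<in> sets borel" for J u A i
    using that unfolding E_def by auto
  have key: "expectation (\<lambda>\<omega>. \<Prod>i\<in>I. E J u A i (X i \<omega>)) = (\<Prod>i\<in>I. expectation (\<lambda>\<omega>. E J u A i (X i \<omega>)))"
    if "finite J" "J \<subseteq> I" "\<And>i. i \<in> I \<Longrightarrow> 0 \<le> u i" "\<And>i. A i \<in> sets borel" for J u A
    using that
  \<comment> \<open>\<open>u\<close> has to vary: the step uses the hypothesis with the entry at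
    \<open>j\<close> reset to each natural number \<open>n\<close>.\<close>
  proof (induction J arbitrary: u rule: finite_induct)
    case empty
    have *: "AE \<omega> in M. \<forall>i\<in>I. E {} u A i (X i \<omega>) = exp (- u i * X i \<omega>)"
    proof (subst AE_finite_all[OF I], intro ballI)
      fix i assume "i \<in> I"
      then show "AE \<omega> in M. E {} u A i (X i \<omega>) = exp (- u i * X i \<omega>)"
        using X0[of i] empty by (auto elim!: eventually_mono simp: E_def)
    qed
    have "expectation (\<lambda>\<omega>. \<Prod>i\<in>I. E {} u A i (X i \<omega>)) = expectation (\<lambda>\<omega>. \<Prod>i\<in>I. exp (- u i * X i \<omega>))"
      by (rule integral_cong_AE) (use * empty in \<open>auto elim!: eventually_mono intro!: prod.cong borel_measurable_prod\<close>)
    also have "\<dots> = (\<Prod>i\<in>I. expectation (\<lambda>\<omega>. exp (- u i * X i \<omega>)))"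
      using empty by (intro eq) auto
    also have "\<dots> = (\<Prod>i\<in>I. expectation (\<lambda>\<omega>. E {} u A i (X i \<omega>)))"
    proof (intro prod.cong refl integral_cong_AE)
      fix i assume "i \<in> I"
      then show "AE \<omega> in M. exp (- u i * X i \<omega>) = E {} u A i (X i \<omega>)"
        using * by (auto elim!: eventually_mono)
    qed (use empty in auto)
    finally show ?case .
  next
    case (insert j J)
    have j: "j \<in> I" and J: "J \<subseteq> I" using insert.prems by auto
    note [measurable] = insert.prems(3)
    \<comment> \<open>The random weight \<open>V\<close> is compared with the constant
      \<open>C\<close>, the product of the means of its factors. The hypothesis makes them agree
      against every \<open>exp (- n * X j)\<close>, hence also against the indicator of
      \<open>A j\<close>.\<close>
    define V where "V \<omega> = (\<Prod>i\<in>I - {j}. E J u A i (X i \<omega>))" for \<omega>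
    define C where "C = (\<Prod>i\<in>I - {j}. expectation (\<lambda>\<omega>. E J u A i (X i \<omega>)))"
    have V01: "0 \<le> V \<omega>" "V \<omega> \<le> 1" for \<omega>
      by (auto simp: V_def intro!: prod_nonneg prod_le_1 E01)
    have Vm[measurable]: "V \<in> borel_measurable M"
      unfolding V_def using insert.prems(3) by (auto intro!: borel_measurable_prod)
    have Vi: "integrable M V"
      by (rule integrable_const_bound[of _ 1]) (use V01 in auto)
    have C0: "0 \<le> C" by (auto simp: C_def intro!: prod_nonneg Bochner_Integration.integral_nonneg E01)
    have jX: "random_variable borel (X j)" using j by simp
    have eqn: "expectation (\<lambda>\<omega>. V \<omega> * exp (- real n * X j \<omega>)) = expectation (\<lambda>\<omega>. C * exp (- real n * X j \<omega>))" for n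
    proof -
      define u' where "u' = u(j := real n)"
      have X: "AE \<omega> in M. E J u' A j (X j \<omega>) = exp (- real n * X j \<omega>)"
        using X0[OF j] insert.hyps by (auto elim!: eventually_mono simp: E_def u'_def)
      have E': "E J u' A i x = E J u A i x" if "i \<noteq> j" for i x using that by (simp add: E_def u'_def)
      have "expectation (\<lambda>\<omega>. \<Prod>i\<in>I. E J u' A i (X i \<omega>)) = expectation (\<lambda>\<omega>. V \<omega> * exp (- real n * X j \<omega>))"
      proof (rule integral_cong_AE)
        show "AE \<omega> in M. (\<Prod>i\<in>I. E J u' A i (X i \<omega>)) = V \<omega> * exp (- real n * X j \<omega>)"
          using X by eventually_elim (simp add: prod.remove[OF I j] V_def E' mult.commute)
      qed (use insert.prems(3) j in \<open>auto intro!: borel_measurable_prod\<close>)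
      moreover have "(\<Prod>i\<in>I. expectation (\<lambda>\<omega>. E J u' A i (X i \<omega>))) = expectation (\<lambda>\<omega>. C * exp (- real n * X j \<omega>))"
      proof -
        have "expectation (\<lambda>\<omega>. E J u' A j (X j \<omega>)) = expectation (\<lambda>\<omega>. exp (- real n * X j \<omega>))"
          by (rule integral_cong_AE) (use X insert.prems(3) j in auto)
        then show ?thesis by (simp add: prod.remove[OF I j] C_def E')
      qed
      moreover have "expectation (\<lambda>\<omega>. \<Prod>i\<in>I. E J u' A i (X i \<omega>)) = (\<Prod>i\<in>I. expectation (\<lambda>\<omega>. E J u' A i (X i \<omega>)))"
        by (rule insert.IH) (use insert.prems J in \<open>auto simp: u'_def\<close>)
      ultimately show ?thesis by simp
    qed
    have "expectation (\<lambda>\<omega>. V \<omega> * indicator (A j) (X j \<omega>)) = expectation (\<lambda>\<omega>. C * indicator (A j) (X j \<omega>))"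
      by (rule weighted_laplace_unique[OF jX X0[OF j] Vi V01(1) _ C0 eqn]) (use insert.prems in auto)
    moreover have E': "E (insert j J) u A i x = E J u A i x" if "i \<noteq> j" for i x
      using that by (simp add: E_def)
    moreover have "E (insert j J) u A j x = indicator (A j) x" for x by (simp add: E_def)
    ultimately show ?case
      by (simp add: prod.remove[OF I j] V_def C_def mult.commute)
  qed
  \<comment> \<open>Uniqueness of product measures asks for sigma-finite factors at every index,
    while \<open>X i\<close> is only known to be measurable on \<open>I\<close>; a point mass fills
    in elsewhere.\<close>
  have D: "product_prob_space (\<lambda>i. if i \<in> I then distr M borel (X i) else return borel 0)"
    by (intro product_prob_spaceI) (auto intro!: prob_space_distr prob_space_return)
  have "distr M (\<Pi>\<^sub>M i\<in>I. borel) (\<lambda>x. \<lambda>i\<in>I. X i x) = (\<Pi>\<^sub>M i\<in>I. if i \<in> I then distr M borel (X i) else return borel 0)"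
  proof (rule product_sigma_finite.PiM_eqI)
    show "product_sigma_finite (\<lambda>i. if i \<in> I then distr M borel (X i) else return borel 0)"
      using D by (simp add: product_prob_space_def)
    show "sets (distr M (\<Pi>\<^sub>M i\<in>I. borel) (\<lambda>x. \<lambda>i\<in>I. X i x)) =
      sets (\<Pi>\<^sub>M i\<in>I. if i \<in> I then distr M borel (X i) else return borel 0)"
      by (simp, intro sets_PiM_cong) auto
    fix A :: "'i \<Rightarrow> real set"
    assume A: "\<And>i. i \<in> I \<Longrightarrow> A i \<in> sets (if i \<in> I then distr M borel (X i) else return borel 0)"
    \<comment> \<open>\<open>key\<close> wants Borel sets at all indices, and \<open>A\<close> is
      Borel only on \<open>I\<close>.\<close>
    define A' where "A' i = (if i \<in> I then A i else {})" for i
    have A': "A' i \<in> sets borel" for i using A[of i] by (auto simp: A'_def)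
    have [measurable]: "i \<in> I \<Longrightarrow> A i \<in> sets borel" for i using A[of i] by auto
    have ev: "{\<omega> \<in> space M. X i \<omega> \<in> A i} \<in> events" if "i \<in> I" for i using that by measurable
    have ind: "(\<Prod>i\<in>I. E I (\<lambda>_. 0) A' i (X i \<omega>)) = indicator {\<omega>\<in>space M. \<forall>i\<in>I. X i \<omega> \<in> A i} \<omega>"
      if "\<omega> \<in> space M" for \<omega>
      using that I by (auto simp: E_def A'_def indicator_def prod_zero_iff intro!: prod.neutral)
    have evA: "{\<omega>\<in>space M. \<forall>i\<in>I. X i \<omega> \<in> A i} \<in> events"
      using I by (intro sets.sets_Collect_finite_All' False) (auto intro: ev)
    have "prob {\<omega>\<in>space M. \<forall>i\<in>I. X i \<omega> \<in> A i} = expectation (\<lambda>\<omega>. \<Prod>i\<in>I. E I (\<lambda>_. 0) A' i (X i \<omega>))"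
      using evA by (simp add: ind cong: Bochner_Integration.integral_cong)
    also have "\<dots> = (\<Prod>i\<in>I. expectation (\<lambda>\<omega>. E I (\<lambda>_. 0) A' i (X i \<omega>)))"
      by (rule key) (use I A' in auto)
    also have "\<dots> = (\<Prod>i\<in>I. prob {\<omega>\<in>space M. X i \<omega> \<in> A i})"
    proof (intro prod.cong refl)
      fix i assume "i \<in> I"
      then have "expectation (\<lambda>\<omega>. E I (\<lambda>_. 0) A' i (X i \<omega>)) = expectation (indicator {\<omega>\<in>space M. X i \<omega> \<in> A i})"
        by (intro Bochner_Integration.integral_cong refl) (auto simp: E_def A'_def indicator_def)
      then show "expectation (\<lambda>\<omega>. E I (\<lambda>_. 0) A' i (X i \<omega>)) = prob {\<omega>\<in>space M. X i \<omega> \<in> A i}"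
        using ev[OF \<open>i \<in> I\<close>] by simp
    qed
    finally have p: "prob {\<omega>\<in>space M. \<forall>i\<in>I. X i \<omega> \<in> A i} = (\<Prod>i\<in>I. prob {\<omega>\<in>space M. X i \<omega> \<in> A i})" .
    have "emeasure (distr M (\<Pi>\<^sub>M i\<in>I. borel) (\<lambda>x. \<lambda>i\<in>I. X i x)) (Pi\<^sub>E I A) =
        emeasure M {\<omega>\<in>space M. \<forall>i\<in>I. X i \<omega> \<in> A i}"
      using I A by (subst emeasure_distr) (auto intro!: measurable_restrict sets_PiM_I_finite arg_cong[where f = "emeasure M"])
    also have "\<dots> = (\<Prod>i\<in>I. ennreal (prob {\<omega>\<in>space M. X i \<omega> \<in> A i}))"
      by (simp add: emeasure_eq_measure p prod_ennreal)
    also have "\<dots> = (\<Prod>i\<in>I. emeasure (if i \<in> I then distr M borel (X i) else return borel 0) (A i))"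
      by (intro prod.cong refl)
         (auto simp: emeasure_distr emeasure_eq_measure vimage_def Int_def conj_commute)
    finally show "emeasure (distr M (\<Pi>\<^sub>M i\<in>I. borel) (\<lambda>x. \<lambda>i\<in>I. X i x)) (Pi\<^sub>E I A) =
      (\<Prod>i\<in>I. emeasure (if i \<in> I then distr M borel (X i) else return borel 0) (A i))" .
  qed (fact I)
  also have "\<dots> = (\<Pi>\<^sub>M i\<in>I. distr M borel (X i))" by (rule PiM_cong) auto
  finally show ?thesis
    using False by (subst indep_vars_iff_distr_eq_PiM') auto
qed

subsection \<open>Infinite product spaces\<close>

lemma indep_vars_PiM_coordinates:
  assumes D: "\<And>i. i \<in> I \<Longrightarrow> prob_space (D i)" and I: "I \<noteq> {}"
  shows "prob_space.indep_vars (PiM I D) D (\<lambda>i \<omega>. \<omega> i) I"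
proof -
  interpret prob_space "PiM I D" by (rule prob_space_PiM) (rule D)
  have "distr (PiM I D) (PiM I D) (\<lambda>x. \<lambda>i\<in>I. x i) = distr (PiM I D) (PiM I D) (\<lambda>x. x)"
    by (rule distr_cong) (auto simp: space_PiM PiE_iff extensional_restrict)
  also have "\<dots> = PiM I (\<lambda>i. distr (PiM I D) (D i) (\<lambda>\<omega>. \<omega> i))"
    using D by (subst distr_id) (auto intro!: PiM_cong simp: distr_PiM_component)
  finally show ?thesis
    using I by (subst indep_vars_iff_distr_eq_PiM') auto
qed

text \<open>Used at two levels: for the jumps inside a block, and for the blocks themselves.\<close>

lemma nn_integral_PiM_prod:
  fixes f :: "'i \<Rightarrow> 'a \<Rightarrow> ennreal"
  assumes D: "\<And>i. prob_space (D i)" and J: "finite J"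
    and f[measurable]: "\<And>i. i \<in> J \<Longrightarrow> f i \<in> borel_measurable (D i)"
  shows "(\<integral>\<^sup>+\<omega>. (\<Prod>i\<in>J. f i (\<omega> i)) \<partial>PiM UNIV D) = (\<Prod>i\<in>J. \<integral>\<^sup>+x. f i x \<partial>D i)"
proof -
  interpret prob_space "PiM UNIV D" by (rule prob_space_PiM) (rule D)
  have iv: "indep_vars D (\<lambda>i \<omega>. \<omega> i) J"
    by (rule indep_vars_subset[OF indep_vars_PiM_coordinates]) (auto intro: D)
  have "indep_vars (\<lambda>_. borel) (\<lambda>i \<omega>. f i (\<omega> i)) J"
    by (rule indep_vars_compose2[OF iv f])
  then have "(\<integral>\<^sup>+\<omega>. (\<Prod>i\<in>J. f i (\<omega> i)) \<partial>PiM UNIV D) = (\<Prod>i\<in>J. \<integral>\<^sup>+\<omega>. f i (\<omega> i) \<partial>PiM UNIV D)"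
    by (intro indep_vars_nn_integral J) auto
  also have "\<dots> = (\<Prod>i\<in>J. \<integral>\<^sup>+x. f i x \<partial>D i)"
  proof (intro prod.cong refl)
    fix i assume "i \<in> J"
    have "(\<integral>\<^sup>+x. f i x \<partial>distr (PiM UNIV D) (D i) (\<lambda>\<omega>. \<omega> i)) = (\<integral>\<^sup>+\<omega>. f i (\<omega> i) \<partial>PiM UNIV D)"
      using \<open>i \<in> J\<close> by (subst nn_integral_distr) auto
    then show "(\<integral>\<^sup>+\<omega>. f i (\<omega> i) \<partial>PiM UNIV D) = (\<integral>\<^sup>+x. f i x \<partial>D i)"
      by (simp add: distr_PiM_component D)
  qed
  finally show ?thesis .
qed

text \<open>\<open>e k\<close> enumerates the coordinates of block \<open>k\<close>; disjoint ranges
  make the blocks functions of disjoint sets of independent coordinates.\<close>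

lemma indep_vars_PiM_blocks:
  fixes D :: "'i \<Rightarrow> 'a measure" and e :: "'k \<Rightarrow> 'j \<Rightarrow> 'i"
  assumes D: "\<And>i. prob_space (D i)"
    and disj: "disjoint_family_on (\<lambda>k. range (e k)) L"
  shows "prob_space.indep_vars (PiM UNIV D) (\<lambda>k. PiM UNIV (\<lambda>j. D (e k j))) (\<lambda>k \<omega> j. \<omega> (e k j)) L"
proof -
  interpret prob_space "PiM UNIV D" by (rule prob_space_PiM) (rule D)
  have "indep_vars (\<lambda>k. PiM (range (e k)) D) (\<lambda>k \<omega>. restrict (\<lambda>i. \<omega> i) (range (e k))) L"
    by (rule indep_vars_restrict[OF indep_vars_PiM_coordinates _ disj]) (auto intro: D)
  then have "indep_vars (\<lambda>k. PiM UNIV (\<lambda>j. D (e k j)))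
     (\<lambda>k \<omega>. (\<lambda>x j. x (e k j)) (restrict (\<lambda>i. \<omega> i) (range (e k)))) L"
    by (rule indep_vars_compose2) (auto intro!: measurable_PiM_single' simp: space_PiM PiE_iff)
  then show ?thesis by simp
qed

lemma distr_PiM_block:
  fixes D :: "'i \<Rightarrow> 'a measure" and e :: "'j \<Rightarrow> 'i"
  assumes D: "\<And>i. prob_space (D i)" and "inj e"
  shows "distr (PiM UNIV D) (PiM UNIV (\<lambda>j. D (e j))) (\<lambda>\<omega> j. \<omega> (e j)) = PiM UNIV (\<lambda>j. D (e j))"
  using distr_PiM_reindex[of UNIV D e UNIV] assms by (simp add: restrict_UNIV)

text \<open>A process on \<open>P\<close> can be carried over to a sample space of real sequences once \<open>P\<close> is the
  image of a product measure on sequences; closure under pairs and countable products lets the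
  Poisson construction use whatever sample space is convenient.\<close>

definition real_sequence_image :: "'a measure \<Rightarrow> bool" where
  "real_sequence_image P \<longleftrightarrow>
     (\<exists>(D :: nat \<Rightarrow> real measure) T. (\<forall>i. prob_space (D i)) \<and>
        T \<in> measurable (PiM UNIV D) P \<and> distr (PiM UNIV D) P T = P)"

lemma real_sequence_image_real:
  assumes "prob_space (P :: real measure)"
  shows "real_sequence_image P"
  unfolding real_sequence_image_def using assms
  by (intro exI[of _ "\<lambda>_. P"] exI[of _ "\<lambda>\<omega>. \<omega> 0"])
     (auto simp: distr_PiM_component[of UNIV "\<lambda>_. P"])

text \<open>The pairing function on the naturals packs countably many sequences into one. The map
  for factor \<open>k\<close> reads only its own subsequence, so the images are independent with the
  right marginals.\<close>

lemma real_sequence_image_PiM: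
  fixes P :: "nat \<Rightarrow> 'a measure"
  assumes "\<And>k. real_sequence_image (P k)"
  shows "real_sequence_image (PiM UNIV P)"
proof -
  obtain D :: "nat \<Rightarrow> nat \<Rightarrow> real measure" and T where D: "\<And>k i. prob_space (D k i)"
    and T[measurable]: "\<And>k. T k \<in> measurable (PiM UNIV (D k)) (P k)"
    and distr: "\<And>k. distr (PiM UNIV (D k)) (P k) (T k) = P k"
    using assms unfolding real_sequence_image_def by metis
  define D' where "D' n = D (fst (prod_decode n)) (snd (prod_decode n))" for n
  define e where "e k j = prod_encode (k, j)" for k j
  have D': "prob_space (D' i)" for i by (simp add: D'_def D)
  have De: "(\<lambda>j. D' (e k j)) = D k" for k by (simp add: D'_def e_def)
  have inj: "inj (e k)" for k by (auto simp: e_def inj_on_def)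
  interpret prob_space "PiM UNIV D'" by (rule prob_space_PiM) (rule D')
  have bm[measurable]: "(\<lambda>\<omega> j. \<omega> (e k j)) \<in> measurable (PiM UNIV D') (PiM UNIV (D k))" for k
    unfolding De[symmetric] by (auto intro!: measurable_PiM_single' simp: space_PiM PiE_iff)
  have "indep_vars (\<lambda>k. PiM UNIV (\<lambda>j. D' (e k j))) (\<lambda>k \<omega> j. \<omega> (e k j)) UNIV"
    by (rule indep_vars_PiM_blocks[OF D']) (auto simp: e_def disjoint_family_on_def)
  then have "indep_vars P (\<lambda>k \<omega>. T k (\<lambda>j. \<omega> (e k j))) UNIV"
    by (rule indep_vars_compose2) (auto simp: De T)
  then have "distr (PiM UNIV D') (PiM UNIV P) (\<lambda>\<omega>. \<lambda>k\<in>UNIV. T k (\<lambda>j. \<omega> (e k j))) =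
    PiM UNIV (\<lambda>k. distr (PiM UNIV D') (P k) (\<lambda>\<omega>. T k (\<lambda>j. \<omega> (e k j))))"
    by (subst (asm) indep_vars_iff_distr_eq_PiM') auto
  moreover have "distr (PiM UNIV D') (P k) (\<lambda>\<omega>. T k (\<lambda>j. \<omega> (e k j))) = P k" for k
    using distr_distr[OF T[of k] bm[of k]] distr_PiM_block[where D = D' and e = "e k", OF D' inj]
    by (simp add: De distr comp_def)
  ultimately have *: "distr (PiM UNIV D') (PiM UNIV P) (\<lambda>\<omega> k. T k (\<lambda>j. \<omega> (e k j))) = PiM UNIV P"
    by (simp add: restrict_UNIV)
  show ?thesis unfolding real_sequence_image_def
  proof (intro exI conjI)
    show "distr (PiM UNIV D') (PiM UNIV P) (\<lambda>\<omega> k. T k (\<lambda>j. \<omega> (e k j))) = PiM UNIV P" by (rule *)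
    show "(\<lambda>\<omega> k. T k (\<lambda>j. \<omega> (e k j))) \<in> measurable (PiM UNIV D') (PiM UNIV P)"
      using measurable_restrict[of UNIV "\<lambda>k \<omega>. T k (\<lambda>j. \<omega> (e k j))" "PiM UNIV D'" P] by (simp add: restrict_UNIV)
  qed (use D' in auto)
qed

text \<open>Interleaving: the even coordinates feed \<open>P\<close> and the odd ones feed
  \<open>Q\<close>.\<close>

lemma real_sequence_image_pair:
  assumes "real_sequence_image P" "real_sequence_image Q"
  shows "real_sequence_image (P \<Otimes>\<^sub>M Q)"
proof -
  obtain D1 :: "nat \<Rightarrow> real measure" and T1 where D1: "\<And>i. prob_space (D1 i)"
    and T1[measurable]: "T1 \<in> measurable (PiM UNIV D1) P"
    and distr1: "distr (PiM UNIV D1) P T1 = P"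
    using assms(1) unfolding real_sequence_image_def by metis
  obtain D2 :: "nat \<Rightarrow> real measure" and T2 where D2: "\<And>i. prob_space (D2 i)"
    and T2[measurable]: "T2 \<in> measurable (PiM UNIV D2) Q"
    and distr2: "distr (PiM UNIV D2) Q T2 = Q"
    using assms(2) unfolding real_sequence_image_def by metis
  define D where "D n = (if even n then D1 (n div 2) else D2 (n div 2))" for n
  define e where "e b j = (if b then 2 * j else 2 * j + 1)" for b and j :: nat
  have D: "prob_space (D i)" for i by (simp add: D_def D1 D2)
  have De: "(\<lambda>j. D (e True j)) = D1" "(\<lambda>j. D (e False j)) = D2"
    by (auto simp: D_def e_def fun_eq_iff)
  have inj: "inj (e b)" for b by (auto simp: e_def inj_on_def)
  interpret prob_space "PiM UNIV D" by (rule prob_space_PiM) (rule D)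
  have bm1[measurable]: "(\<lambda>\<omega> j. \<omega> (e True j)) \<in> measurable (PiM UNIV D) (PiM UNIV D1)"
    unfolding De[symmetric] by (auto intro!: measurable_PiM_single' simp: space_PiM PiE_iff)
  have bm2[measurable]: "(\<lambda>\<omega> j. \<omega> (e False j)) \<in> measurable (PiM UNIV D) (PiM UNIV D2)"
    unfolding De[symmetric] by (auto intro!: measurable_PiM_single' simp: space_PiM PiE_iff)
  have "indep_vars (\<lambda>b. PiM UNIV (\<lambda>j. D (e b j))) (\<lambda>b \<omega> j. \<omega> (e b j)) UNIV"
  proof (rule indep_vars_PiM_blocks[OF D])
    have "2 * i \<noteq> Suc (2 * j)" for i j :: nat by presburger
    then show "disjoint_family_on (\<lambda>b. range (e b)) UNIV"
      unfolding disjoint_family_on_def UNIV_bool e_def by (auto, metis+)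
  qed
  also have "(\<lambda>b. PiM UNIV (\<lambda>j. D (e b j))) = case_bool (PiM UNIV D1) (PiM UNIV D2)"
    by (auto simp: fun_eq_iff De split: bool.split)
  also have "(\<lambda>b (\<omega> :: nat \<Rightarrow> real) j. \<omega> (e b j)) = case_bool (\<lambda>\<omega> j. \<omega> (e True j)) (\<lambda>\<omega> j. \<omega> (e False j))"
    by (auto simp: fun_eq_iff split: bool.split)
  finally have "indep_var (PiM UNIV D1) (\<lambda>\<omega> j. \<omega> (e True j)) (PiM UNIV D2) (\<lambda>\<omega> j. \<omega> (e False j))"
    unfolding indep_var_def .
  then have joint: "PiM UNIV D1 \<Otimes>\<^sub>M PiM UNIV D2 =
     distr (PiM UNIV D) (PiM UNIV D1 \<Otimes>\<^sub>M PiM UNIV D2) (\<lambda>\<omega>. (\<lambda>j. \<omega> (e True j), \<lambda>j. \<omega> (e False j)))"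
    unfolding indep_var_distribution_eq
    using distr_PiM_block[where D = D and e = "e True", OF D inj] distr_PiM_block[where D = D and e = "e False", OF D inj] by (simp add: De)
  interpret D2: prob_space "PiM UNIV D2" by (rule prob_space_PiM) (rule D2)
  have "sigma_finite_measure Q"
    using D2.prob_space_distr[OF T2] by (simp add: distr2 prob_space_imp_sigma_finite)
  then have "P \<Otimes>\<^sub>M Q = distr (PiM UNIV D1 \<Otimes>\<^sub>M PiM UNIV D2) (P \<Otimes>\<^sub>M Q) (\<lambda>(x, y). (T1 x, T2 y))"
    using pair_measure_distr[OF T1 T2] by (simp add: distr1 distr2)
  also have "\<dots> = distr (PiM UNIV D) (P \<Otimes>\<^sub>M Q) (\<lambda>\<omega>. (T1 (\<lambda>j. \<omega> (e True j)), T2 (\<lambda>j. \<omega> (e False j))))"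
    by (subst joint, subst distr_distr) (auto simp: comp_def)
  finally have *: "distr (PiM UNIV D) (P \<Otimes>\<^sub>M Q) (\<lambda>\<omega>. (T1 (\<lambda>j. \<omega> (e True j)), T2 (\<lambda>j. \<omega> (e False j)))) = P \<Otimes>\<^sub>M Q"
    by simp
  show ?thesis unfolding real_sequence_image_def
    by (intro exI[of _ D] exI[of _ "\<lambda>\<omega>. (T1 (\<lambda>j. \<omega> (e True j)), T2 (\<lambda>j. \<omega> (e False j)))"] conjI *)
       (use D in auto)
qed

subsection \<open>Compound Poisson processes\<close>

text \<open>The fallback value 1 keeps the jump time in (k, k + 1] for every real \<open>u\<close>,
  so cutting the sum at finitely many blocks is exact on every path.\<close>

definition jump_time :: "nat \<Rightarrow> real \<Rightarrow> real" where
  "jump_time k u = real k + (if 0 < u \<and> u \<le> 1 then u else 1)"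

lemma jump_time_gt: "real k < jump_time k u"
  by (auto simp: jump_time_def)

lemma jump_time_measurable[measurable]: "jump_time k \<in> borel_measurable borel"
  unfolding jump_time_def by measurable

abbreviation uniform01 :: "real measure" where
  "uniform01 \<equiv> uniform_measure lborel {0<..1}"

text \<open>The count is stored as a real number so that every component of the sample space is a
  probability measure on the reals, as the transport to real sequences requires.\<close>

definition poisson_real :: "real \<Rightarrow> real measure" where
  "poisson_real l = distr (measure_pmf (poisson_pmf l)) borel real"

text \<open>Infinitely many marks are supplied and only as many as the count are read. This makes
  count and marks independent by the product form alone.\<close>

definition block_measure :: "real \<Rightarrow> real measure \<Rightarrow> (real \<times> (nat \<Rightarrow> real \<times> real)) measure" where
  "block_measure l \<rho> = poisson_real l \<Otimes>\<^sub>M PiM UNIV (\<lambda>_. uniform01 \<Otimes>\<^sub>M \<rho>)"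

definition cpp_space :: "real \<Rightarrow> real measure \<Rightarrow> (nat \<Rightarrow> real \<times> (nat \<Rightarrow> real \<times> real)) measure" where
  "cpp_space l \<rho> = PiM UNIV (\<lambda>_. block_measure l \<rho>)"

text \<open>The block \<open>\<omega> k\<close> holds the number of jumps in \<open>(k, k + 1]\<close> and the times (relative to \<open>k\<close>)
  and sizes of these jumps.  The clamping in \<open>jump_time\<close> and the absolute value only matter on a
  null set; they make every path monotone and cadlag.\<close>

definition cpp_sum :: "nat \<Rightarrow> real \<Rightarrow> (nat \<Rightarrow> real \<times> (nat \<Rightarrow> real \<times> real)) \<Rightarrow> real" where
  "cpp_sum K t \<omega> = (\<Sum>k<K. \<Sum>j<nat \<lfloor>fst (\<omega> k)\<rfloor>.
     indicator {..t} (jump_time k (fst (snd (\<omega> k) j))) * \<bar>snd (snd (\<omega> k) j)\<bar>)"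

definition cpp :: "real \<Rightarrow> (nat \<Rightarrow> real \<times> (nat \<Rightarrow> real \<times> real)) \<Rightarrow> real" where
  "cpp t = cpp_sum (nat \<lceil>t\<rceil>) t"

text \<open>Blocks from \<lceil>t\<rceil> on contain only jumps after \<open>t\<close>. Several
  times can thus share one \<open>K\<close>, and increments become differences taken term by
  term.\<close>

lemma cpp_eq_sum:
  assumes "t \<le> real K"
  shows "cpp t \<omega> = cpp_sum K t \<omega>"
  unfolding cpp_def cpp_sum_def
proof (rule sum.mono_neutral_left)
  show "{..<nat \<lceil>t\<rceil>} \<subseteq> {..<K}" using assms by (simp add: nat_le_iff ceiling_le_iff)
  show "\<forall>k\<in>{..<K} - {..<nat \<lceil>t\<rceil>}. (\<Sum>j<nat \<lfloor>fst (\<omega> k)\<rfloor>.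
     indicator {..t} (jump_time k (fst (snd (\<omega> k) j))) * \<bar>snd (snd (\<omega> k) j)\<bar>) = 0"
  proof
    fix k assume "k \<in> {..<K} - {..<nat \<lceil>t\<rceil>}"
    then have "t \<le> real k" by auto
    then have "\<not> jump_time k u \<le> t" for u using jump_time_gt[of k u] by linarith
    then show "(\<Sum>j<nat \<lfloor>fst (\<omega> k)\<rfloor>.
     indicator {..t} (jump_time k (fst (snd (\<omega> k) j))) * \<bar>snd (snd (\<omega> k) j)\<bar>) = 0" by simp
  qed
qed simp

lemma cpp_mono: "s \<le> t \<Longrightarrow> cpp s \<omega> \<le> cpp t \<omega>"
proof -
  assume "s \<le> t"
  obtain K :: nat where K: "t \<le> real K" using real_arch_simple by blast
  have "cpp_sum K s \<omega> \<le> cpp_sum K t \<omega>"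
    unfolding cpp_sum_def using \<open>s \<le> t\<close>
    by (intro sum_mono mult_right_mono) (auto simp: indicator_def)
  then show ?thesis using K \<open>s \<le> t\<close> by (simp add: cpp_eq_sum[of _ K])
qed

lemma cpp_0[simp]: "cpp 0 \<omega> = 0" by (simp add: cpp_def cpp_sum_def)

text \<open>Near each time a path is a fixed finite sum of step functions; for a jump time
  \<open>c\<close> the left limit at \<open>t\<close> turns \<open>{..t}\<close> into
  \<open>{..<t}\<close>.\<close>

lemma cpp_cadlag: "cadlag_path (\<lambda>t. cpp t \<omega>)"
proof -
  have r: "((\<lambda>s. indicator {..s} c :: real) \<longlongrightarrow> indicator {..t} c) (at_right t)" for c t :: real
  proof (rule tendsto_eventually, cases "c \<le> t")
    case True
    then show "\<forall>\<^sub>F s in at_right t. (indicator {..s} c :: real) = indicator {..t} c"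
      by (auto simp: eventually_at_right_field indicator_def intro!: exI[of _ "t + 1"])
  next
    case False
    then show "\<forall>\<^sub>F s in at_right t. (indicator {..s} c :: real) = indicator {..t} c"
      by (auto simp: eventually_at_right_field indicator_def intro!: exI[of _ c])
  qed
  have l: "((\<lambda>s. indicator {..s} c :: real) \<longlongrightarrow> indicator {..<t} c) (at_left t)" for c t :: real
  proof (rule tendsto_eventually, cases "c < t")
    case True
    then show "\<forall>\<^sub>F s in at_left t. (indicator {..s} c :: real) = indicator {..<t} c"
      by (auto simp: eventually_at_left_field indicator_def intro!: exI[of _ c])
  next
    case False
    then show "\<forall>\<^sub>F s in at_left t. (indicator {..s} c :: real) = indicator {..<t} c"
      by (auto simp: eventually_at_left_field indicator_def intro!: exI[of _ "t - 1"])
  qed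
  have "((\<lambda>s. cpp s \<omega>) \<longlongrightarrow> cpp t \<omega>) (at_right t)" for t
  proof -
    \<comment> \<open>The margin of 1 makes the same \<open>K\<close> valid on a right neighbourhood
      of \<open>t\<close>.\<close>
    obtain K :: nat where K: "t + 1 \<le> real K" using real_arch_simple by blast
    have "((\<lambda>s. cpp_sum K s \<omega>) \<longlongrightarrow> cpp_sum K t \<omega>) (at_right t)"
      unfolding cpp_sum_def by (intro tendsto_sum tendsto_mult r tendsto_const)
    moreover have "\<forall>\<^sub>F s in at_right t. cpp_sum K s \<omega> = cpp s \<omega>"
      using K by (auto simp: eventually_at_right_field cpp_eq_sum[of _ K] intro!: exI[of _ "t + 1"])
    ultimately show ?thesis
      using K by (simp add: cpp_eq_sum[of t K] tendsto_cong)
  qed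
  moreover have "\<exists>l. ((\<lambda>s. cpp s \<omega>) \<longlongrightarrow> l) (at_left t)" for t
  proof -
    obtain K :: nat where K: "t \<le> real K" using real_arch_simple by blast
    have "((\<lambda>s. cpp_sum K s \<omega>) \<longlongrightarrow> (\<Sum>k<K. \<Sum>j<nat \<lfloor>fst (\<omega> k)\<rfloor>.
        indicator {..<t} (jump_time k (fst (snd (\<omega> k) j))) * \<bar>snd (snd (\<omega> k) j)\<bar>)) (at_left t)"
      unfolding cpp_sum_def by (intro tendsto_sum tendsto_mult l tendsto_const)
    moreover have "\<forall>\<^sub>F s in at_left t. cpp_sum K s \<omega> = cpp s \<omega>"
      using K by (auto simp: eventually_at_left_field cpp_eq_sum[of _ K] intro!: exI[of _ "t - 1"])
    ultimately show ?thesis by (auto simp: tendsto_cong)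
  qed
  ultimately show ?thesis by (simp add: cadlag_path_def)
qed

lemma measure_jump_time_le:
  "measure uniform01 {u. jump_time k u \<le> t} = max 0 (min 1 (t - real k))"
proof -
  have "measure uniform01 {u. jump_time k u \<le> t} = measure lborel ({0<..1} \<inter> {u. jump_time k u \<le> t})"
    by (subst measure_uniform_measure) auto
  also have "{0<..1} \<inter> {u. jump_time k u \<le> t} = {0<..min 1 (t - real k)}"
    by (auto simp: jump_time_def)
  also have "measure lborel \<dots> = max 0 (min 1 (t - real k))"
    by (cases "0 \<le> min 1 (t - real k)") auto
  finally show ?thesis .
qed

text \<open>A nondecreasing sequence with values 0 and 1 increases at most once, so at most one
  factor differs from 1 and the product equals its affine expansion. With \<open>b i\<close> telling
  whether a jump has occurred by \<open>t i\<close>, this is the linearisation that allows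
  integration term by term.\<close>

lemma prod_exp_steps:
  fixes b v :: "nat \<Rightarrow> real"
  assumes "\<And>i. i \<le> n \<Longrightarrow> b i = 0 \<or> b i = 1" "\<And>i j. i \<le> j \<Longrightarrow> j \<le> n \<Longrightarrow> b i \<le> b j"
  shows "(\<Prod>i<n. exp (- (v i * (b (Suc i) - b i)))) = 1 - (\<Sum>i<n. (b (Suc i) - b i) * (1 - exp (- v i)))"
  using assms
proof (induction n)
  case (Suc n)
  have IH: "(\<Prod>i<n. exp (- (v i * (b (Suc i) - b i)))) = 1 - (\<Sum>i<n. (b (Suc i) - b i) * (1 - exp (- v i)))"
    by (rule Suc.IH) (use Suc.prems in auto)
  consider "b n = 0" | "b n = 1" using Suc.prems(1)[of n] by auto
  then show ?case
  proof cases
    case 1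
    have z: "b i = 0" if "i \<le> n" for i
      using Suc.prems(1)[of i] Suc.prems(2)[of i n] that 1 by auto
    then have "(\<Sum>i<n. (b (Suc i) - b i) * (1 - exp (- v i))) = 0" by (intro sum.neutral) auto
    moreover have "(\<Prod>i<n. exp (- (v i * (b (Suc i) - b i)))) = 1" using z by (intro prod.neutral) auto
    ultimately show ?thesis using Suc.prems(1)[of "Suc n"] 1 by auto
  next
    case 2
    then have "b (Suc n) = 1" using Suc.prems(1)[of "Suc n"] Suc.prems(2)[of n "Suc n"] by auto
    then show ?thesis using IH 2 by simp
  qed
qed simp

text \<open>Each summand is the length of the part of (k, k + 1] below \<open>t\<close>, and these
  parts tile the interval from 0 to \<open>min K t\<close>.\<close>

lemma sum_clipped_lengths:
  assumes "0 \<le> t"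
  shows "(\<Sum>k<K. max 0 (min 1 (t - real k))) = min (real K) t"
  using assms by (induction K) (auto simp: max_def min_def)

section \<open>The joint Laplace transform of the increments of a compound Poisson process\<close>

locale compound_poisson =
  fixes l :: real and \<rho> :: "real measure"
  assumes l: "0 < l" and prob_rho: "prob_space \<rho>" and sets_rho[measurable_cong]: "sets \<rho> = sets borel"
    and rho_nonneg: "AE y in \<rho>. 0 \<le> y"
begin

sublocale rho: prob_space \<rho> by (rule prob_rho)

lemma prob_uniform01: "prob_space uniform01"
  by (rule prob_space_uniform_measure) auto

lemma prob_poisson_real: "prob_space (poisson_real l)"
  unfolding poisson_real_def by (intro prob_space.prob_space_distr) (auto simp: measure_pmf.prob_space_axioms)

lemma sets_poisson_real[measurable_cong, simp]: "sets (poisson_real l) = sets borel"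
  by (simp add: poisson_real_def)

lemma prob_mark: "prob_space (uniform01 \<Otimes>\<^sub>M \<rho>)"
  by (intro prob_space_pair prob_uniform01 prob_rho)

lemma prob_block: "prob_space (block_measure l \<rho>)"
  unfolding block_measure_def
  by (intro prob_space_pair prob_poisson_real prob_space_PiM prob_mark)

sublocale prob_space "cpp_space l \<rho>"
  unfolding cpp_space_def by (intro prob_space_PiM prob_block)

lemma real_sequence_image_cpp_space: "real_sequence_image (cpp_space l \<rho>)"
  unfolding cpp_space_def block_measure_def
  by (intro real_sequence_image_PiM real_sequence_image_pair real_sequence_image_real
        prob_uniform01 prob_poisson_real prob_rho)

lemma measurable_block[measurable]:
  "(\<lambda>x. fst x) \<in> borel_measurable (block_measure l \<rho>)"
  "(\<lambda>x. fst (snd x j)) \<in> borel_measurable (block_measure l \<rho>)"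
  "(\<lambda>x. snd (snd x j)) \<in> borel_measurable (block_measure l \<rho>)"
  unfolding block_measure_def by measurable

lemma measurable_cpp_space_component:
  "f \<in> measurable (block_measure l \<rho>) N \<Longrightarrow> (\<lambda>\<omega>. f (\<omega> k)) \<in> measurable (cpp_space l \<rho>) N"
  unfolding cpp_space_def by (rule measurable_compose[OF measurable_component_singleton]) auto

lemma measurable_cpp[measurable]: "cpp t \<in> borel_measurable (cpp_space l \<rho>)"
proof -
  have "(\<lambda>x. \<Sum>j<nat \<lfloor>fst x\<rfloor>.
     indicator {..t} (jump_time k (fst (snd x j))) * \<bar>snd (snd x j)\<bar>) \<in> borel_measurable (block_measure l \<rho>)" for k
  proof -
    \<comment> \<open>The number of summands is random; measurability follows by splitting over its
      countably many values.\<close>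
    have n: "(\<lambda>x. nat \<lfloor>fst x\<rfloor>) \<in> measurable (block_measure l \<rho>) (count_space UNIV)" by measurable
    show ?thesis
      by (rule measurable_compose_countable[OF _ n, of "\<lambda>n x. \<Sum>j<n.
        indicator {..t} (jump_time k (fst (snd x j))) * \<bar>snd (snd x j)\<bar>"]) measurable
  qed
  then show ?thesis
    unfolding cpp_def cpp_sum_def
    by (intro borel_measurable_sum measurable_cpp_space_component)
qed

text \<open>This is the Poisson generating function; \<open>nat \<lfloor>x\<rfloor>\<close> recovers
  the count from its real encoding.\<close>

lemma nn_integral_poisson_power:
  assumes "0 \<le> c"
  shows "(\<integral>\<^sup>+x. ennreal c ^ nat \<lfloor>x\<rfloor> \<partial>poisson_real l) = ennreal (exp (- l * (1 - c)))"
proof -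
  have "(\<integral>\<^sup>+x. ennreal c ^ nat \<lfloor>x\<rfloor> \<partial>poisson_real l) = (\<integral>\<^sup>+n. ennreal c ^ n \<partial>measure_pmf (poisson_pmf l))"
    unfolding poisson_real_def by (subst nn_integral_distr) auto
  also have "\<dots> = (\<Sum>n. ennreal (pmf (poisson_pmf l) n) * ennreal c ^ n)"
    by (simp add: nn_integral_measure_pmf nn_integral_count_space_nat)
  also have "\<dots> = (\<Sum>n. ennreal ((l * c) ^ n / fact n * exp (- l)))"
    using l assms
    by (intro arg_cong[where f = suminf])
       (auto simp: fun_eq_iff ennreal_power ennreal_mult[symmetric] power_mult_distrib field_simps)
  also have "\<dots> = ennreal (exp (l * c) * exp (- l))"
  proof (intro suminf_ennreal_eq sums_mult2)
    show "(\<lambda>n. (l * c) ^ n / fact n) sums exp (l * c)"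
      using exp_converges[of "l * c"] by (simp add: divide_inverse mult.commute scaleR_conv_of_real)
  qed (use l assms in auto)
  also have "exp (l * c) * exp (- l) = exp (- l * (1 - c))"
    by (simp add: exp_add[symmetric] algebra_simps)
  finally show ?thesis .
qed

text \<open>Given the count, the marks are independent and identically distributed, so the product
  averages to a power of the mean of \<open>g\<close>; the generating function then sums over the
  count. It is the Laplace functional of a Poisson random measure on one block.\<close>

lemma nn_integral_block_prod:
  fixes g :: "real \<times> real \<Rightarrow> real"
  assumes g[measurable]: "g \<in> borel_measurable (borel \<Otimes>\<^sub>M borel)" and g01: "\<And>z. 0 \<le> g z" "\<And>z. g z \<le> 1"
  shows "(\<integral>\<^sup>+x. (\<Prod>j<nat \<lfloor>fst x\<rfloor>. ennreal (g (snd x j))) \<partial>block_measure l \<rho>) =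
    ennreal (exp (- l * (1 - (LINT z|(uniform01 \<Otimes>\<^sub>M \<rho>). g z))))"
proof -
  interpret N: prob_space "poisson_real l" by (rule prob_poisson_real)
  interpret Z: prob_space "uniform01 \<Otimes>\<^sub>M \<rho>" by (rule prob_mark)
  interpret W: prob_space "PiM (UNIV :: nat set) (\<lambda>_. uniform01 \<Otimes>\<^sub>M \<rho>)"
    by (intro prob_space_PiM prob_mark)
  have [measurable]: "g \<in> borel_measurable (uniform01 \<Otimes>\<^sub>M \<rho>)" by measurable
  have gm: "(\<lambda>w. ennreal (g w)) \<in> borel_measurable (uniform01 \<Otimes>\<^sub>M \<rho>)" by measurable
  have "(\<lambda>x. \<Prod>j<nat \<lfloor>fst x\<rfloor>. ennreal (g (snd x j))) \<in> borel_measurable (block_measure l \<rho>)"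
  proof -
    have n: "(\<lambda>x. nat \<lfloor>fst x\<rfloor>) \<in> measurable (block_measure l \<rho>) (count_space UNIV)" by measurable
    show ?thesis
      by (rule measurable_compose_countable[OF _ n, of "\<lambda>n x. \<Prod>j<n. ennreal (g (snd x j))"])
         (unfold block_measure_def, measurable)
  qed
  then have "(\<integral>\<^sup>+x. (\<Prod>j<nat \<lfloor>fst x\<rfloor>. ennreal (g (snd x j))) \<partial>block_measure l \<rho>) =
    (\<integral>\<^sup>+n. (\<integral>\<^sup>+w. (\<Prod>j<nat \<lfloor>n\<rfloor>. ennreal (g (w j))) \<partial>PiM UNIV (\<lambda>_. uniform01 \<Otimes>\<^sub>M \<rho>)) \<partial>poisson_real l)"
    unfolding block_measure_def by (subst W.nn_integral_fst[symmetric]) auto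
  also have "\<dots> = (\<integral>\<^sup>+n. (\<Prod>j<nat \<lfloor>n\<rfloor>. \<integral>\<^sup>+z. ennreal (g z) \<partial>(uniform01 \<Otimes>\<^sub>M \<rho>)) \<partial>poisson_real l)"
    by (intro nn_integral_cong nn_integral_PiM_prod prob_mark gm) auto
  also have "(\<integral>\<^sup>+z. ennreal (g z) \<partial>(uniform01 \<Otimes>\<^sub>M \<rho>)) = ennreal (LINT z|(uniform01 \<Otimes>\<^sub>M \<rho>). g z)"
    using g01 by (intro nn_integral_eq_integral Z.integrable_const_bound[of _ 1]) auto
  also have "(\<integral>\<^sup>+n. (\<Prod>j<nat \<lfloor>n\<rfloor>. ennreal (LINT z|(uniform01 \<Otimes>\<^sub>M \<rho>). g z)) \<partial>poisson_real l) =
    ennreal (exp (- l * (1 - (LINT z|(uniform01 \<Otimes>\<^sub>M \<rho>). g z))))"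
    using g01 by (simp add: nn_integral_poisson_power Bochner_Integration.integral_nonneg)
  finally show ?thesis .
qed

definition laplace_exp :: "real \<Rightarrow> real" where
  "laplace_exp u = l * (1 - (LINT y|\<rho>. exp (- u * y)))"

text \<open>Regrouping the exponential by jumps gives one factor \<open>g k\<close> per jump.
  Independence of the blocks and the block formula leave an exponent linear in the mean of
  \<open>g k\<close>, and that mean splits over the grid intervals.\<close>

lemma joint_laplace:
  fixes t u :: "nat \<Rightarrow> real"
  assumes t0: "0 \<le> t 0" and mono: "mono_on {..n} t" and u: "\<And>i. i < n \<Longrightarrow> 0 \<le> u i"
  shows "expectation (\<lambda>\<omega>. \<Prod>i<n. exp (- u i * (cpp (t (Suc i)) \<omega> - cpp (t i) \<omega>))) =
    (\<Prod>i<n. exp (- (t (Suc i) - t i) * laplace_exp (u i)))"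
proof -
  obtain K :: nat where K: "t n \<le> real K" using real_arch_simple by blast
  have tm: "t i \<le> t j" if "i \<le> j" "j \<le> n" for i j using mono_onD[OF mono] that by auto
  have tK: "t i \<le> real K" and tp: "0 \<le> t i" if "i \<le> n" for i
    using tm[of i n] tm[of 0 i] that K t0 by auto
  \<comment> \<open>\<open>b k w i\<close> tells whether a jump of block \<open>k\<close> with mark
    time \<open>w\<close> has occurred by \<open>t i\<close>; \<open>g k\<close> is the total factor
    which a jump with mark \<open>z\<close> contributes to the joint transform.\<close>
  define b where "b k w i = (indicator {..t i} (jump_time k w) :: real)" for k w i
  define g where "g k z = (\<Prod>i<n. exp (- (u i * \<bar>snd z\<bar> * (b k (fst z) (Suc i) - b k (fst z) i))))"
    for k and z :: "real \<times> real"
  have bm: "b k w i \<le> b k w j" if "i \<le> j" "j \<le> n" for k w i j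
    using tm[OF that] by (auto simp: b_def indicator_def)
  have [measurable]: "(\<lambda>w. b k w i) \<in> borel_measurable borel" for k i unfolding b_def by measurable
  have gm[measurable]: "g k \<in> borel_measurable (borel \<Otimes>\<^sub>M borel)" for k unfolding g_def by measurable
  have g01: "0 \<le> g k z" "g k z \<le> 1" for k z
    unfolding g_def using u bm
    by (auto intro!: prod_nonneg prod_le_1 mult_nonneg_nonneg simp: le_diff_eq)
  have g_eq: "g k z = 1 - (\<Sum>i<n. (b k (fst z) (Suc i) - b k (fst z) i) * (1 - exp (- (u i * \<bar>snd z\<bar>))))" for k z
    unfolding g_def by (rule prod_exp_steps) (use bm in \<open>auto simp: b_def indicator_def\<close>)
  have "(\<Prod>i<n. exp (- u i * (cpp (t (Suc i)) \<omega> - cpp (t i) \<omega>))) =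
      (\<Prod>k<K. \<Prod>j<nat \<lfloor>fst (\<omega> k)\<rfloor>. g k (snd (\<omega> k) j))" for \<omega>
  proof -
    have "cpp (t (Suc i)) \<omega> - cpp (t i) \<omega> = (\<Sum>k<K. \<Sum>j<nat \<lfloor>fst (\<omega> k)\<rfloor>. \<bar>snd (snd (\<omega> k) j)\<bar> *
        (b k (fst (snd (\<omega> k) j)) (Suc i) - b k (fst (snd (\<omega> k) j)) i))" if "i < n" for i
    proof -
      have *: "cpp (t (Suc i)) \<omega> = cpp_sum K (t (Suc i)) \<omega>" "cpp (t i) \<omega> = cpp_sum K (t i) \<omega>"
        using that by (auto intro!: cpp_eq_sum tK)
      show ?thesis
        unfolding * cpp_sum_def b_def by (simp only: sum_subtractf right_diff_distrib mult.commute)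
    qed
    then have "(\<Prod>i<n. exp (- u i * (cpp (t (Suc i)) \<omega> - cpp (t i) \<omega>))) =
      (\<Prod>i<n. \<Prod>k<K. \<Prod>j<nat \<lfloor>fst (\<omega> k)\<rfloor>. exp (- (u i * \<bar>snd (snd (\<omega> k) j)\<bar> *
        (b k (fst (snd (\<omega> k) j)) (Suc i) - b k (fst (snd (\<omega> k) j)) i))))"
      by (intro prod.cong refl) (simp add: sum_distrib_left exp_sum sum_negf[symmetric] mult.assoc del: sum_negf)
    also have "\<dots> = (\<Prod>k<K. \<Prod>i<n. \<Prod>j<nat \<lfloor>fst (\<omega> k)\<rfloor>. exp (- (u i * \<bar>snd (snd (\<omega> k) j)\<bar> *
        (b k (fst (snd (\<omega> k) j)) (Suc i) - b k (fst (snd (\<omega> k) j)) i))))"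
      by (rule prod.swap)
    also have "\<dots> = (\<Prod>k<K. \<Prod>j<nat \<lfloor>fst (\<omega> k)\<rfloor>. g k (snd (\<omega> k) j))"
      unfolding g_def by (intro prod.cong refl prod.swap)
    finally show ?thesis .
  qed
  then have "ennreal (\<Prod>i<n. exp (- u i * (cpp (t (Suc i)) \<omega> - cpp (t i) \<omega>))) =
      (\<Prod>k<K. \<Prod>j<nat \<lfloor>fst (\<omega> k)\<rfloor>. ennreal (g k (snd (\<omega> k) j)))" for \<omega>
    by (simp add: prod_ennreal g01 prod_nonneg)
  then have "(\<integral>\<^sup>+\<omega>. ennreal (\<Prod>i<n. exp (- u i * (cpp (t (Suc i)) \<omega> - cpp (t i) \<omega>))) \<partial>cpp_space l \<rho>) =
     (\<integral>\<^sup>+\<omega>. (\<Prod>k<K. (\<lambda>x. \<Prod>j<nat \<lfloor>fst x\<rfloor>. ennreal (g k (snd x j))) (\<omega> k)) \<partial>cpp_space l \<rho>)"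
    by simp
  also have "\<dots> = (\<Prod>k<K. \<integral>\<^sup>+x. (\<Prod>j<nat \<lfloor>fst x\<rfloor>. ennreal (g k (snd x j))) \<partial>block_measure l \<rho>)"
    unfolding cpp_space_def
  proof (rule nn_integral_PiM_prod[OF prob_block])
    fix k
    have n: "(\<lambda>x. nat \<lfloor>fst x\<rfloor>) \<in> measurable (block_measure l \<rho>) (count_space UNIV)" by measurable
    show "(\<lambda>x. \<Prod>j<nat \<lfloor>fst x\<rfloor>. ennreal (g k (snd x j))) \<in> borel_measurable (block_measure l \<rho>)"
      by (rule measurable_compose_countable[OF _ n, of "\<lambda>n x. \<Prod>j<n. ennreal (g k (snd x j))"])
         (unfold block_measure_def, measurable)
  qed simp
  also have "\<dots> = (\<Prod>k<K. ennreal (exp (- l * (1 - (LINT z|(uniform01 \<Otimes>\<^sub>M \<rho>). g k z)))))"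
    by (intro prod.cong refl nn_integral_block_prod gm g01)
  also have "\<dots> = ennreal (exp (\<Sum>k<K. - l * (1 - (LINT z|(uniform01 \<Otimes>\<^sub>M \<rho>). g k z))))"
    by (simp add: prod_ennreal exp_sum)
  \<comment> \<open>The uniform mark time gives grid interval \<open>i\<close> the length of its
    overlap with block \<open>k\<close>, and the jump size gives the integral in
    \<open>laplace_exp (u i)\<close>. Summed over the blocks, the overlaps make up the whole grid
    interval.\<close>
  also have "(\<Sum>k<K. - l * (1 - (LINT z|(uniform01 \<Otimes>\<^sub>M \<rho>). g k z))) =
    (\<Sum>i<n. - (t (Suc i) - t i) * laplace_exp (u i))"
  proof -
    interpret U: prob_space uniform01 by (rule prob_uniform01)
    interpret Z: pair_prob_space uniform01 \<rho> ..
    have um: "(\<lambda>w. b k w i) \<in> borel_measurable uniform01" for k i by measurable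
    have ub: "integrable uniform01 (\<lambda>w. b k w i)" for k i
      by (rule U.integrable_const_bound[of _ 1]) (auto simp: b_def)
    have bi: "(LINT w|uniform01. b k w i) = max 0 (min 1 (t i - real k))" for k i
    proof -
      have "(LINT w|uniform01. b k w i) = (LINT w|uniform01. indicator {u. jump_time k u \<le> t i} w)"
        by (intro Bochner_Integration.integral_cong) (auto simp: b_def indicator_def)
      then show ?thesis by (simp add: measure_jump_time_le)
    qed
    have ri: "integrable \<rho> (\<lambda>y. exp (- (v * \<bar>y\<bar>)))" if "0 \<le> v" for v
      by (rule rho.integrable_const_bound[of _ 1]) (use that in auto)
    have rl: "l * (1 - (LINT y|\<rho>. exp (- (v * \<bar>y\<bar>)))) = laplace_exp v" for v
    proof -
      have "AE y in \<rho>. exp (- (v * \<bar>y\<bar>)) = exp (- v * y)"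
        using rho_nonneg by eventually_elim simp
      then have "(LINT y|\<rho>. exp (- (v * \<bar>y\<bar>))) = (LINT y|\<rho>. exp (- v * y))"
        by (intro integral_cong_AE) auto
      then show ?thesis unfolding laplace_exp_def by simp
    qed
    have "1 - (LINT z|(uniform01 \<Otimes>\<^sub>M \<rho>). g k z) =
      (\<Sum>i<n. (max 0 (min 1 (t (Suc i) - real k)) - max 0 (min 1 (t i - real k))) *
        (1 - (LINT y|\<rho>. exp (- (u i * \<bar>y\<bar>)))))" for k
    proof -
      have gi: "integrable (uniform01 \<Otimes>\<^sub>M \<rho>) (g k)"
        by (rule Z.integrable_const_bound[of _ 1]) (use g01 in auto)
      have "(LINT z|(uniform01 \<Otimes>\<^sub>M \<rho>). g k z) = (LINT w|uniform01. LINT y|\<rho>. g k (w, y))"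
        using Z.integral_fst'[OF gi] by simp
      also have "\<dots> = (LINT w|uniform01. 1 - (\<Sum>i<n. (b k w (Suc i) - b k w i) *
          (1 - (LINT y|\<rho>. exp (- (u i * \<bar>y\<bar>))))))"
      proof (intro Bochner_Integration.integral_cong refl)
        fix w
        have "(LINT y|\<rho>. g k (w, y)) = (LINT y|\<rho>. 1 - (\<Sum>i<n. (b k w (Suc i) - b k w i) * (1 - exp (- (u i * \<bar>y\<bar>)))))"
          by (simp add: g_eq)
        also have "\<dots> = 1 - (\<Sum>i<n. LINT y|\<rho>. (b k w (Suc i) - b k w i) * (1 - exp (- (u i * \<bar>y\<bar>))))"
          using ri u by (subst Bochner_Integration.integral_diff)
            (auto simp: rho.prob_space intro!: Bochner_Integration.integral_sum)
        also have "\<dots> = 1 - (\<Sum>i<n. (b k w (Suc i) - b k w i) * (1 - (LINT y|\<rho>. exp (- (u i * \<bar>y\<bar>)))))"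
          using ri u by (simp add: rho.prob_space)
        finally show "(LINT y|\<rho>. g k (w, y)) = 1 - (\<Sum>i<n. (b k w (Suc i) - b k w i) *
          (1 - (LINT y|\<rho>. exp (- (u i * \<bar>y\<bar>)))))" .
      qed
      also have "\<dots> = 1 - (\<Sum>i<n. (LINT w|uniform01. (b k w (Suc i) - b k w i) *
          (1 - (LINT y|\<rho>. exp (- (u i * \<bar>y\<bar>))))))"
        using ub by (subst Bochner_Integration.integral_diff)
            (auto simp: U.prob_space intro!: Bochner_Integration.integral_sum)
      also have "\<dots> = 1 - (\<Sum>i<n. (max 0 (min 1 (t (Suc i) - real k)) - max 0 (min 1 (t i - real k))) *
          (1 - (LINT y|\<rho>. exp (- (u i * \<bar>y\<bar>)))))"
        using ub by (simp add: bi)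
      finally show ?thesis by simp
    qed
    then have "(\<Sum>k<K. - l * (1 - (LINT z|(uniform01 \<Otimes>\<^sub>M \<rho>). g k z))) =
      (\<Sum>k<K. \<Sum>i<n. - (max 0 (min 1 (t (Suc i) - real k)) - max 0 (min 1 (t i - real k))) * laplace_exp (u i))"
      by (simp only: sum_distrib_left rl[symmetric] minus_mult_commute) (simp add: mult_ac)
    also have "\<dots> = (\<Sum>i<n. \<Sum>k<K. - (max 0 (min 1 (t (Suc i) - real k)) - max 0 (min 1 (t i - real k))) * laplace_exp (u i))"
      by (rule sum.swap)
    also have "\<dots> = (\<Sum>i<n. - ((\<Sum>k<K. max 0 (min 1 (t (Suc i) - real k))) - (\<Sum>k<K. max 0 (min 1 (t i - real k)))) * laplace_exp (u i))"
      by (simp add: sum_subtractf sum_distrib_right[symmetric] sum_negf del: minus_diff_eq)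
    also have "\<dots> = (\<Sum>i<n. - (t (Suc i) - t i) * laplace_exp (u i))"
      using tK tp by (intro sum.cong refl) (simp add: sum_clipped_lengths min_absorb2)
    finally show ?thesis .
  qed
  finally have "(\<integral>\<^sup>+\<omega>. ennreal (\<Prod>i<n. exp (- u i * (cpp (t (Suc i)) \<omega> - cpp (t i) \<omega>))) \<partial>cpp_space l \<rho>) =
    ennreal (\<Prod>i<n. exp (- (t (Suc i) - t i) * laplace_exp (u i)))"
    by (simp add: exp_sum)
  then show ?thesis
    by (subst integral_eq_nn_integral) (auto simp: prod_nonneg)
qed

end

text \<open>Grids with a single interval show that the transform of an increment depends only on its
  length, which gives stationarity; the factorised transform on general grids then gives
  independence.\<close>

lemma (in prob_space) subordinatorI_joint_laplace:
  fixes S :: "real \<Rightarrow> 'a \<Rightarrow> real" and \<phi> :: "real \<Rightarrow> real"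
  assumes rv: "\<And>t. random_variable borel (S t)"
    and S0: "\<And>\<omega>. S 0 \<omega> = 0"
    and mono: "\<And>s t \<omega>. s \<le> t \<Longrightarrow> S s \<omega> \<le> S t \<omega>"
    and cadlag: "\<And>\<omega>. cadlag_path (\<lambda>t. S t \<omega>)"
    and joint: "\<And>n t u. 0 \<le> t 0 \<Longrightarrow> mono_on {..n} t \<Longrightarrow> (\<And>i. i < n \<Longrightarrow> 0 \<le> u i) \<Longrightarrow>
      expectation (\<lambda>\<omega>. \<Prod>i<n. exp (- u i * (S (t (Suc i)) \<omega> - S (t i) \<omega>))) =
      (\<Prod>i<n. exp (- (t (Suc i) - t i) * \<phi> (u i)))"
  shows "subordinator M S" and "has_laplace_exponent M S \<phi>"
proof -
  note [measurable] = rv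
  have inc: "expectation (\<lambda>\<omega>. exp (- u * (S t \<omega> - S s \<omega>))) = exp (- (t - s) * \<phi> u)"
    if "0 \<le> s" "s \<le> t" "0 \<le> u" for s t u
    using joint[of "\<lambda>j. if j = 0 then s else t" 1 "\<lambda>_. u"] that by (simp add: mono_on_def)
  have "independent_increments M S"
    unfolding independent_increments_def
  proof (intro allI impI, elim conjE)
    fix n and t :: "nat \<Rightarrow> real" assume t: "0 \<le> t 0" "mono_on {..n} t"
    have tm: "t i \<le> t j" if "i \<le> j" "j \<le> n" for i j using mono_onD[OF t(2)] that by auto
    have tp: "0 \<le> t i" if "i \<le> n" for i using tm[of 0 i] that t(1) by auto
    show "indep_vars (\<lambda>_. borel) (\<lambda>i \<omega>. S (t (Suc i)) \<omega> - S (t i) \<omega>) {..<n}"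
    proof (rule indep_vars_laplace)
      fix u :: "nat \<Rightarrow> real" assume u: "\<And>i. i \<in> {..<n} \<Longrightarrow> 0 \<le> u i"
      have "(\<Prod>i<n. expectation (\<lambda>\<omega>. exp (- u i * (S (t (Suc i)) \<omega> - S (t i) \<omega>)))) =
        (\<Prod>i<n. exp (- (t (Suc i) - t i) * \<phi> (u i)))"
        using u by (intro prod.cong refl inc tp tm) auto
      then show "expectation (\<lambda>\<omega>. \<Prod>i<n. exp (- u i * (S (t (Suc i)) \<omega> - S (t i) \<omega>))) =
        (\<Prod>i<n. expectation (\<lambda>\<omega>. exp (- u i * (S (t (Suc i)) \<omega> - S (t i) \<omega>))))"
        using joint[OF t, of u] u by simp
    qed (auto intro!: AE_I2 simp: mono tm)
  qed
  moreover have "stationary_increments M S"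
    unfolding stationary_increments_def
  proof (intro allI impI)
    fix s t :: real assume st: "0 \<le> s" "0 \<le> t"
    show "distr M borel (\<lambda>\<omega>. S (s + t) \<omega> - S s \<omega>) = distr M borel (\<lambda>\<omega>. S t \<omega> - S 0 \<omega>)"
    proof (rule distr_eqI_laplace)
      show "expectation (\<lambda>\<omega>. exp (- real n * (S (s + t) \<omega> - S s \<omega>))) =
        expectation (\<lambda>\<omega>. exp (- real n * (S t \<omega> - S 0 \<omega>)))" for n
        using inc[of s "s + t" "real n"] inc[of 0 t "real n"] st by simp
    qed (use st in \<open>auto intro!: AE_I2 mono\<close>)
  qed
  moreover have "stochastically_continuous M S"
    unfolding stochastically_continuous_def
  proof (intro allI impI)
    fix t e :: real assume t: "0 \<le> t" and e: "0 < e"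
    have ce: "1 - exp (- e) > 0" using e by simp
    \<comment> \<open>Markov's inequality for \<open>1 - exp (- x)\<close> at the increment, which
      is bounded, so no moments of \<open>S\<close> are required.\<close>
    have bound: "prob {\<omega> \<in> space M. \<bar>S b \<omega> - S a \<omega>\<bar> > e} \<le> (1 - exp (- (b - a) * \<phi> 1)) / (1 - exp (- e))"
      if "0 \<le> a" "a \<le> b" for a b
    proof -
      define D where "D = {\<omega> \<in> space M. \<bar>S b \<omega> - S a \<omega>\<bar> > e}"
      have [measurable]: "D \<in> events" unfolding D_def by measurable
      have ie: "integrable M (\<lambda>\<omega>. exp (- 1 * (S b \<omega> - S a \<omega>)))"
        by (rule integrable_const_bound[of _ 1]) (auto simp: mono that)
      have "expectation (\<lambda>\<omega>. (1 - exp (- e)) * indicator D \<omega>) \<le> expectation (\<lambda>\<omega>. 1 - exp (- 1 * (S b \<omega> - S a \<omega>)))"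
      proof (rule integral_mono)
        show "integrable M (\<lambda>\<omega>. 1 - exp (- 1 * (S b \<omega> - S a \<omega>)))"
          by (intro Bochner_Integration.integrable_diff integrable_const ie)
        fix \<omega> assume "\<omega> \<in> space M"
        then show "(1 - exp (- e)) * indicator D \<omega> \<le> 1 - exp (- 1 * (S b \<omega> - S a \<omega>))"
          using mono[OF that(2), of \<omega>] by (auto simp: D_def indicator_def)
      qed (auto simp: less_top[symmetric])
      also have "\<dots> = 1 - exp (- (b - a) * \<phi> 1)"
        using inc[OF that, of 1] by (subst Bochner_Integration.integral_diff[OF integrable_const ie]) (simp add: prob_space)
      finally have "(1 - exp (- e)) * prob D \<le> 1 - exp (- (b - a) * \<phi> 1)"
        by (subst (asm) integral_mult_right_zero) simp
      then show ?thesis using ce by (simp add: D_def[symmetric] pos_le_divide_eq mult.commute)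
    qed
    show "((\<lambda>s. prob {\<omega> \<in> space M. \<bar>S s \<omega> - S t \<omega>\<bar> > e}) \<longlongrightarrow> 0) (at t within {0..})"
    proof (rule tendsto_sandwich[where f = "\<lambda>_. 0"])
      show "\<forall>\<^sub>F s in at t within {0..}. prob {\<omega> \<in> space M. \<bar>S s \<omega> - S t \<omega>\<bar> > e} \<le>
         (1 - exp (- \<bar>s - t\<bar> * \<phi> 1)) / (1 - exp (- e))"
        unfolding eventually_at_filter
      proof (intro always_eventually allI impI)
        fix s :: real assume "s \<in> {0..}"
        then show "prob {\<omega> \<in> space M. \<bar>S s \<omega> - S t \<omega>\<bar> > e} \<le>
         (1 - exp (- \<bar>s - t\<bar> * \<phi> 1)) / (1 - exp (- e))"
          using bound[of t s] bound[of s t] t by (cases "s \<le> t") (auto simp: abs_minus_commute)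
      qed
      have "((\<lambda>s. (1 - exp (- \<bar>s - t\<bar> * \<phi> 1)) / (1 - exp (- e))) \<longlongrightarrow>
        (1 - exp (- \<bar>t - t\<bar> * \<phi> 1)) / (1 - exp (- e))) (at t within {0..})"
        using ce by (intro tendsto_intros) auto
      then show "((\<lambda>s. (1 - exp (- \<bar>s - t\<bar> * \<phi> 1)) / (1 - exp (- e))) \<longlongrightarrow> 0) (at t within {0..})"
        by simp
    qed auto
  qed
  ultimately show "subordinator M S"
    unfolding subordinator_def levy_process_def
    by (auto simp: prob_space_axioms S0 cadlag mono_on_def mono)
  show "has_laplace_exponent M S \<phi>"
    unfolding has_laplace_exponent_def using inc[of 0] by (simp add: S0)
qed

text \<open>The rate is the total mass of \<pi> and the jump law its normalisation, for which the
  mass must be finite and nonzero.\<close>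

theorem exists_compound_poisson_subordinator:
  fixes \<pi> :: "real measure"
  assumes fin: "finite_measure \<pi>" and sets: "sets \<pi> = sets borel" and nz: "emeasure \<pi> UNIV \<noteq> 0"
    and nonneg: "AE x in \<pi>. 0 \<le> x"
  shows "\<exists>(M :: (nat \<Rightarrow> real) measure) S. subordinator M S \<and>
    has_laplace_exponent M S (\<lambda>\<eta>. LINT s|\<pi>. 1 - exp (- s * \<eta>))"
proof -
  interpret pi: finite_measure \<pi> by fact
  have sp: "space \<pi> = UNIV" using sets_eq_imp_space_eq[OF sets] by simp
  define l where "l = measure \<pi> UNIV"
  have l: "0 < l" using nz by (simp add: l_def pi.emeasure_eq_measure less_le)
  define \<rho> where "\<rho> = density \<pi> (\<lambda>_. ennreal (1 / l))"
  have "emeasure \<rho> (space \<rho>) = 1"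
    using l unfolding \<rho>_def
    by (subst emeasure_density_const)
       (auto simp: sets sp pi.emeasure_eq_measure l_def ennreal_mult[symmetric])
  then have "prob_space \<rho>" by (rule prob_spaceI)
  moreover have "AE y in \<rho>. 0 \<le> y" unfolding \<rho>_def by (subst AE_density) (use nonneg in auto)
  moreover have "sets \<rho> = sets borel" by (simp add: \<rho>_def sets)
  ultimately interpret compound_poisson l \<rho> using l by (simp add: compound_poisson_def)
  have rho_int: "(LINT y|\<rho>. f y) = (LINT y|\<pi>. f y) / l" if "f \<in> borel_measurable borel" for f :: "real \<Rightarrow> real"
    proof -
    have "f \<in> borel_measurable \<pi>" using that sets by (simp cong: measurable_cong_sets)
    then show ?thesis using l unfolding \<rho>_def by (subst integral_density) auto
  qed
  have exp_eq: "laplace_exp u = (LINT s|\<pi>. 1 - exp (- s * u))" if "0 < u" for u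
  proof -
    have "integrable \<pi> (\<lambda>s. exp (- s * u))"
    proof (rule pi.integrable_const_bound[of _ 1])
      show "AE s in \<pi>. norm (exp (- s * u)) \<le> 1"
        using nonneg by eventually_elim (use that in simp)
    qed (simp add: sets cong: measurable_cong_sets)
    then have "(LINT s|\<pi>. 1 - exp (- s * u)) = l - (LINT s|\<pi>. exp (- s * u))"
      by (subst Bochner_Integration.integral_diff) (auto simp: l_def sp)
    moreover have "(LINT y|\<rho>. exp (- u * y)) = (LINT s|\<pi>. exp (- s * u)) / l"
      by (subst rho_int) (auto simp: mult.commute)
    ultimately show ?thesis using l by (simp add: laplace_exp_def field_simps)
  qed
  \<comment> \<open>Composing the process with the measure preserving map \<open>T\<close> keeps the
    joint transforms and every pathwise property.\<close>
  obtain D :: "nat \<Rightarrow> real measure" and T where D: "\<And>i. prob_space (D i)"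
    and T[measurable]: "T \<in> measurable (PiM UNIV D) (cpp_space l \<rho>)"
    and distr: "distr (PiM UNIV D) (cpp_space l \<rho>) T = cpp_space l \<rho>"
    using real_sequence_image_cpp_space unfolding real_sequence_image_def by blast
  interpret D: prob_space "PiM UNIV D" by (rule prob_space_PiM) (rule D)
  have joint: "D.expectation (\<lambda>\<omega>. \<Prod>i<n. exp (- u i * (cpp (t (Suc i)) (T \<omega>) - cpp (t i) (T \<omega>)))) =
      (\<Prod>i<n. exp (- (t (Suc i) - t i) * laplace_exp (u i)))"
    if "0 \<le> t 0" "mono_on {..n} t" "\<And>i. i < n \<Longrightarrow> 0 \<le> u i" for n and t u :: "nat \<Rightarrow> real"
  proof -
    let ?f = "\<lambda>\<omega>. \<Prod>i<n. exp (- u i * (cpp (t (Suc i)) \<omega> - cpp (t i) \<omega>))"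
    have "D.expectation (\<lambda>\<omega>. ?f (T \<omega>)) = (LINT \<omega>|distr (PiM UNIV D) (cpp_space l \<rho>) T. ?f \<omega>)"
      by (rule integral_distr[symmetric]) auto
    also have "\<dots> = (\<Prod>i<n. exp (- (t (Suc i) - t i) * laplace_exp (u i)))"
      unfolding distr by (rule joint_laplace[OF that])
    finally show ?thesis .
  qed
  have rv: "(\<lambda>\<omega>. cpp t (T \<omega>)) \<in> borel_measurable (PiM UNIV D)" for t by measurable
  have "subordinator (PiM UNIV D) (\<lambda>t \<omega>. cpp t (T \<omega>))"
    and "has_laplace_exponent (PiM UNIV D) (\<lambda>t \<omega>. cpp t (T \<omega>)) laplace_exp"
    by (rule D.subordinatorI_joint_laplace[OF rv _ _ _ joint]; simp add: cpp_mono cpp_cadlag)+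
  then show ?thesis
    by (intro exI[of _ "PiM UNIV D"] exI[of _ "\<lambda>t \<omega>. cpp t (T \<omega>)"])
       (simp add: has_laplace_exponent_def exp_eq)
qed

subsection \<open>Moments and flat pieces of paths\<close>

text \<open>No integrability of \<open>X\<close> is assumed: monotone convergence yields it together
  with the value. The approximating expectations are first and second difference quotients of
  \<open>L\<close>, so only their limits at 0 from the right matter and nothing is differentiated
  under the expectation.\<close>

lemma (in prob_space) moments_of_laplace_transform:
  fixes X :: "'a \<Rightarrow> real" and L :: "real \<Rightarrow> real"
  assumes X[measurable]: "random_variable borel X" and X0: "AE \<omega> in M. 0 \<le> X \<omega>"
    and L: "\<And>\<eta>. 0 < \<eta> \<Longrightarrow> expectation (\<lambda>\<omega>. exp (- \<eta> * X \<omega>)) = L \<eta>"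
    and m: "((\<lambda>\<eta>. (1 - L \<eta>) / \<eta>) \<longlongrightarrow> m) (at_right 0)"
    and v: "((\<lambda>\<eta>. (1 - 2 * L \<eta> + L (2 * \<eta>)) / \<eta>\<^sup>2) \<longlongrightarrow> v) (at_right 0)"
  shows "integrable M X" "expectation X = m"
    and "integrable M (\<lambda>\<omega>. (X \<omega>)\<^sup>2)" "expectation (\<lambda>\<omega>. (X \<omega>)\<^sup>2) = v"
proof -
  define h :: "nat \<Rightarrow> real" where "h n = (1 / 2) ^ n" for n
  have h: "0 < h n" for n by (simp add: h_def)
  have hlim: "filterlim h (at_right 0) sequentially"
    unfolding filterlim_at_right_to_0 filterlim_at
    using h by (auto intro!: always_eventually LIMSEQ_realpow_zero simp: h_def[abs_def])
  define q where "q n x = (1 - exp (- h n * x)) / h n" for n x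
  have q0: "0 \<le> q n x" if "0 \<le> x" for n x
    using h[of n] that by (auto simp: q_def intro!: divide_nonneg_pos)
  have qmono: "mono (\<lambda>n. q n x)" if "0 \<le> x" for x
  proof (rule incseq_SucI)
    fix n
    \<comment> \<open>Since \<open>h\<close> halves at each step, \<open>exp (- h n * x)\<close> is
      the square of \<open>r\<close>, and monotonicity in \<open>n\<close> becomes (1 - r)^2 \<ge>
      0.\<close>
    define r where "r = exp (- h (Suc n) * x)"
    have "exp (- h n * x) = r\<^sup>2" by (simp add: r_def h_def exp_double[symmetric])
    moreover have "0 \<le> (1 - r)\<^sup>2" by simp
    ultimately have "1 - exp (- h n * x) \<le> 2 * (1 - r)" by (simp add: power2_eq_square algebra_simps)
    then have "(1 - exp (- h n * x)) / h n \<le> 2 * (1 - r) / h n"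
      using h[of n] by (intro divide_right_mono) auto
    also have "\<dots> = (1 - r) / h (Suc n)" by (simp add: h_def)
    finally show "q n x \<le> q (Suc n) x" by (simp add: q_def r_def)
  qed
  have qlim: "(\<lambda>n. q n x) \<longlonglongrightarrow> x" for x
  proof -
    have "((\<lambda>s. - exp (- s * x)) has_real_derivative x) (at 0)"
      by (auto intro!: derivative_eq_intros)
    then have "((\<lambda>s. (1 - exp (- s * x)) / s) \<longlongrightarrow> x) (at 0)"
      by (simp add: DERIV_def)
    then have "((\<lambda>s. (1 - exp (- s * x)) / s) \<longlongrightarrow> x) (at_right 0)"
      by (rule filterlim_mono) (auto simp: at_le)
    from filterlim_compose[OF this hlim] show ?thesis by (simp add: q_def)
  qed
  have ei: "integrable M (\<lambda>\<omega>. exp (- s * X \<omega>))" if "0 < s" for s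
  proof (rule integrable_const_bound[of _ 1])
    show "AE \<omega> in M. norm (exp (- s * X \<omega>)) \<le> 1"
      using X0 by eventually_elim (use that in simp)
  qed simp
  have qi: "integrable M (\<lambda>\<omega>. q n (X \<omega>))" for n
    unfolding q_def using ei[OF h] by (intro integrable_divide Bochner_Integration.integrable_diff) auto
  have qE: "expectation (\<lambda>\<omega>. q n (X \<omega>)) = (1 - L (h n)) / h n" for n
    unfolding q_def using ei[OF h, of n] L[OF h, of n] by (simp add: prob_space)
  have q2: "(q n x)\<^sup>2 = (1 - 2 * exp (- h n * x) + exp (- (2 * h n) * x)) / (h n)\<^sup>2" for n x
    by (simp add: q_def power_divide power2_diff exp_double[symmetric] mult.assoc)
  have q2i: "integrable M (\<lambda>\<omega>. (q n (X \<omega>))\<^sup>2)" for n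
    unfolding q2 using ei[OF h, of n] ei[of "2 * h n"] h[of n]
    by (intro integrable_divide Bochner_Integration.integrable_add Bochner_Integration.integrable_diff) auto
  have q2E: "expectation (\<lambda>\<omega>. (q n (X \<omega>))\<^sup>2) = (1 - 2 * L (h n) + L (2 * h n)) / (h n)\<^sup>2" for n
  proof -
    have "expectation (\<lambda>\<omega>. 1 - 2 * exp (- h n * X \<omega>) + exp (- (2 * h n) * X \<omega>)) = 1 - 2 * L (h n) + L (2 * h n)"
      using ei[OF h, of n] ei[of "2 * h n"] L[OF h, of n] L[of "2 * h n"] h[of n]
      by (subst Bochner_Integration.integral_add) (auto simp: prob_space)
    then show ?thesis unfolding q2 by simp
  qed
  have 1: "AE \<omega> in M. mono (\<lambda>n. q n (X \<omega>))" using X0 by eventually_elim (rule qmono)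
  have 2: "AE \<omega> in M. mono (\<lambda>n. (q n (X \<omega>))\<^sup>2)"
    using X0 by eventually_elim (auto simp: mono_def intro!: power_mono q0 monoD[OF qmono])
  have 3: "AE \<omega> in M. (\<lambda>n. q n (X \<omega>)) \<longlonglongrightarrow> X \<omega>"
    and 4: "AE \<omega> in M. (\<lambda>n. (q n (X \<omega>))\<^sup>2) \<longlonglongrightarrow> (X \<omega>)\<^sup>2"
    by (auto intro!: AE_I2 tendsto_power qlim)
  have 5: "(\<lambda>n. expectation (\<lambda>\<omega>. q n (X \<omega>))) \<longlonglongrightarrow> m"
    unfolding qE by (rule filterlim_compose[OF m hlim])
  have 6: "(\<lambda>n. expectation (\<lambda>\<omega>. (q n (X \<omega>))\<^sup>2)) \<longlonglongrightarrow> v"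
    unfolding q2E by (rule filterlim_compose[OF v hlim])
  show "integrable M X" "expectation X = m"
    using integrable_monotone_convergence[OF qi 1 3 5 X] integral_monotone_convergence[OF qi 1 3 5 X] by auto
  have X2: "(\<lambda>\<omega>. (X \<omega>)\<^sup>2) \<in> borel_measurable M" by measurable
  show "integrable M (\<lambda>\<omega>. (X \<omega>)\<^sup>2)" "expectation (\<lambda>\<omega>. (X \<omega>)\<^sup>2) = v"
    using integrable_monotone_convergence[OF q2i 2 4 6 X2] integral_monotone_convergence[OF q2i 2 4 6 X2] by auto
qed

text \<open>The second derivative is available only at 0, so l'Hopital is applied once. The
  remaining quotient (L'(2x) - L'(x)) / x is the difference quotient at 0 of a function with
  derivative 2D - D there.\<close>

lemma second_difference_tendsto:
  fixes L L' :: "real \<Rightarrow> real"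
  assumes r: "0 < r" and d1: "\<And>x. \<bar>x\<bar> < r \<Longrightarrow> (L has_real_derivative L' x) (at x)"
    and d2: "(L' has_real_derivative D) (at 0)"
  shows "((\<lambda>x. (L 0 - 2 * L x + L (2 * x)) / x\<^sup>2) \<longlongrightarrow> D) (at_right 0)"
proof (rule lhopital_right_0)
  have cont: "isCont L 0" using d1[of 0] r by (auto intro: DERIV_isCont)
  have a: "((\<lambda>x. L x) \<longlongrightarrow> L 0) (at_right 0)"
    using cont by (auto simp: isCont_def intro: filterlim_mono at_le)
  have "((\<lambda>x. 2 * x) \<longlongrightarrow> 2 * 0) (at_right (0::real))" by (intro tendsto_intros)
  then have b: "((\<lambda>x. L (2 * x)) \<longlongrightarrow> L 0) (at_right 0)"
    using isCont_tendsto_compose[of 0 L "\<lambda>x. 2 * x" "at_right 0"] cont by simp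
  have "((\<lambda>x. L 0 - 2 * L x + L (2 * x)) \<longlongrightarrow> L 0 - 2 * L 0 + L 0) (at_right 0)"
    by (intro tendsto_intros a b)
  then show "((\<lambda>x. L 0 - 2 * L x + L (2 * x)) \<longlongrightarrow> 0) (at_right 0)" by simp
  have "((\<lambda>x::real. x\<^sup>2) \<longlongrightarrow> 0\<^sup>2) (at_right 0)" by (intro tendsto_intros)
  then show "((\<lambda>x::real. x\<^sup>2) \<longlongrightarrow> 0) (at_right 0)" by simp
  show "\<forall>\<^sub>F x in at_right 0. DERIV (\<lambda>x. L 0 - 2 * L x + L (2 * x)) x :> 2 * (L' (2 * x) - L' x)"
    unfolding eventually_at_right_field
  proof (intro exI[of _ "r / 2"] conjI allI impI)
    fix x assume "0 < x" "x < r / 2"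
    then have x: "(L has_real_derivative L' x) (at x)" "(L has_real_derivative L' (2 * x)) (at (2 * x))"
      by (auto intro!: d1)
    have "((\<lambda>x. 2 * x) has_real_derivative 2) (at x)" by (auto intro!: derivative_eq_intros)
    from DERIV_chain2[OF x(2) this] x(1)
    show "DERIV (\<lambda>x. L 0 - 2 * L x + L (2 * x)) x :> 2 * (L' (2 * x) - L' x)"
      by (auto intro!: derivative_eq_intros)
  qed (use r in auto)
  show "\<forall>\<^sub>F x in at_right 0. DERIV (\<lambda>x::real. x\<^sup>2) x :> 2 * x"
    by (intro always_eventually allI) (auto intro!: derivative_eq_intros)
  have "((\<lambda>x. L' (2 * x) - L' x) has_real_derivative D * 2 - D) (at 0)"
  proof (rule DERIV_diff[OF _ d2])
    have "((\<lambda>x. 2 * x) has_real_derivative 2) (at (0::real))" by (auto intro!: derivative_eq_intros)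
    from DERIV_chain2[of L' D "\<lambda>x. 2 * x", OF _ this] d2
    show "((\<lambda>x. L' (2 * x)) has_real_derivative D * 2) (at 0)" by simp
  qed
  then have "((\<lambda>x. (L' (2 * x) - L' x) / x) \<longlongrightarrow> D) (at 0)" by (simp add: DERIV_def)
  then have "((\<lambda>x. (L' (2 * x) - L' x) / x) \<longlongrightarrow> D) (at_right 0)"
    by (rule filterlim_mono) (auto simp: at_le)
  then show "((\<lambda>x. 2 * (L' (2 * x) - L' x) / (2 * x)) \<longlongrightarrow> D) (at_right 0)"
    by (subst mult_divide_mult_cancel_left) auto
qed (auto simp: eventually_at_right_field intro!: exI[of _ "1::real"])

section \<open>Subordinators with bounded exponent stay at zero for a while\<close>

lemma subordinator_nonneg:
  assumes "subordinator M S" "0 \<le> t"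
  shows "AE \<omega> in M. 0 \<le> S t \<omega>"
proof -
  have "AE \<omega> in M. S 0 \<omega> = 0" "AE \<omega> in M. mono_on {0..} (\<lambda>t. S t \<omega>)"
    using assms(1) by (auto simp: subordinator_def levy_process_def)
  then show ?thesis
  proof eventually_elim
    case (elim \<omega>)
    then show ?case using mono_onD[OF elim(2), of 0 t] assms(2) by simp
  qed
qed

text \<open>Letting the Laplace argument tend to infinity isolates the event S t = 0, whose
  probability is therefore at least exp(-t c). Along the times 1/(n + 1) the events S t \<noteq> 0
  then have a null intersection, so almost every path takes the value 0 both at 0 and at a positive
  time.\<close>

lemma subordinator_not_strict_mono:
  assumes S: "subordinator M S" and L: "has_laplace_exponent M S \<phi>"
    and bound: "\<And>\<eta>. 0 < \<eta> \<Longrightarrow> \<phi> \<eta> \<le> c"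
  shows "AE \<omega> in M. \<not> strict_mono_on {0..} (\<lambda>t. S t \<omega>)"
proof -
  interpret prob_space M using S by (simp add: subordinator_def levy_process_def)
  have rv[measurable]: "0 \<le> t \<Longrightarrow> S t \<in> borel_measurable M" for t
    using S by (simp add: subordinator_def levy_process_def)
  have zero: "exp (- t * c) \<le> prob {\<omega> \<in> space M. S t \<omega> = 0}" if t: "0 \<le> t" for t
  proof -
    have [measurable]: "S t \<in> borel_measurable M" by (rule rv[OF t])
    have "(\<lambda>n. expectation (\<lambda>\<omega>. exp (- real n * S t \<omega>))) \<longlonglongrightarrow>
        expectation (\<lambda>\<omega>. indicator {\<omega> \<in> space M. S t \<omega> = 0} \<omega>)"
    proof (rule integral_dominated_convergence[where w = "\<lambda>_. 1"])
      show "AE \<omega> in M. (\<lambda>n. exp (- real n * S t \<omega>)) \<longlonglongrightarrow> indicator {\<omega> \<in> space M. S t \<omega> = 0} \<omega>"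
        using subordinator_nonneg[OF S t] AE_space
      proof eventually_elim
        case (elim \<omega>)
        show ?case
        proof (cases "S t \<omega> = 0")
          case False
          then have "norm (exp (- S t \<omega>)) < 1" using elim by simp
          from LIMSEQ_power_zero[OF this] show ?thesis
            using False by (simp add: exp_of_nat_mult[symmetric])
        qed (use elim in simp)
      qed
      show "AE \<omega> in M. norm (exp (- real n * S t \<omega>)) \<le> 1" for n
        using subordinator_nonneg[OF S t] by eventually_elim simp
    qed auto
    moreover have "\<forall>\<^sub>F n in sequentially. exp (- t * c) \<le> expectation (\<lambda>\<omega>. exp (- real n * S t \<omega>))"
      \<comment> \<open>The exponent is specified only for positive arguments, so n = 0 is
        excluded.\<close>
      using eventually_gt_at_top[of 0]
    proof eventually_elim
      case (elim n)
      then have "expectation (\<lambda>\<omega>. exp (- real n * S t \<omega>)) = exp (- t * \<phi> (real n))"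
        using L t by (simp add: has_laplace_exponent_def)
      then show ?case using bound[of "real n"] t elim by (simp add: mult_left_mono)
    qed
    ultimately have "exp (- t * c) \<le> expectation (\<lambda>\<omega>. indicator {\<omega> \<in> space M. S t \<omega> = 0} \<omega>)"
      by (rule tendsto_lowerbound) simp
    then show ?thesis by simp
  qed
  define d where "d n = 1 / real (Suc n)" for n
  have d: "0 < d n" for n by (simp add: d_def)
  define A where "A n = {\<omega> \<in> space M. S (d n) \<omega> \<noteq> 0}" for n
  have Am[measurable]: "A n \<in> events" for n
  proof -
    have [measurable]: "S (d n) \<in> borel_measurable M" by (rule rv) (use d[of n] in simp)
    show ?thesis unfolding A_def by measurable
  qed
  have Ap: "prob (A n) \<le> 1 - exp (- d n * c)" for n
  proof -
    have "{\<omega> \<in> space M. S (d n) \<omega> = 0} = space M - A n" by (auto simp: A_def)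
    then show ?thesis using zero[of "d n"] d[of n] prob_compl[OF Am, of n] by simp
  qed
  have "prob (\<Inter>n. A n) \<le> 1 - exp (- d n * c)" for n
    by (rule order_trans[OF finite_measure_mono Ap]) auto
  moreover have "(\<lambda>n. 1 - exp (- d n * c)) \<longlonglongrightarrow> 1 - exp (- 0 * c)"
    unfolding d_def by (intro tendsto_intros LIMSEQ_Suc[OF lim_1_over_n])
  ultimately have "prob (\<Inter>n. A n) \<le> 0"
    using LIMSEQ_le_const[of "\<lambda>n. 1 - exp (- d n * c)" 0 "prob (\<Inter>n. A n)"] by simp
  then have "(\<Inter>n. A n) \<in> null_sets M"
    by (intro null_setsI) (auto simp: emeasure_eq_measure measure_le_0_iff)
  then have "AE \<omega> in M. \<omega> \<notin> (\<Inter>n. A n)" by (rule AE_not_in)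
  moreover have "AE \<omega> in M. S 0 \<omega> = 0" using S by (simp add: subordinator_def levy_process_def)
  ultimately show ?thesis using AE_space
  proof eventually_elim
    case (elim \<omega>)
    then obtain n where "S (d n) \<omega> = 0" by (auto simp: A_def)
    then show ?case using elim d[of n] strict_mono_onD[of "{0..}" "\<lambda>t. S t \<omega>" 0 "d n"] by auto
  qed
qed

subsection \<open>The exponent and its Levy measure\<close>

lemma set_integrable_lower_gamma:
  fixes \<alpha> x :: real
  assumes "0 < \<alpha>"
  shows "set_integrable lborel {0..x} (\<lambda>w. exp (- w) * w powr (\<alpha> - 1))"
  unfolding set_integrable_def
proof (rule integrableI_bounded)
  have "(\<integral>\<^sup>+w. ennreal (norm (indicator {0..x} w *\<^sub>R (exp (- w) * w powr (\<alpha> - 1)))) \<partial>lborel) \<le>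
     (\<integral>\<^sup>+w. ennreal (indicator {0..} w * w powr (\<alpha> - 1) / exp w) \<partial>lborel)"
    by (intro nn_integral_mono ennreal_leI) (auto simp: indicator_def exp_minus field_simps)
  also have "\<dots> = ennreal (Gamma \<alpha>)" by (rule Gamma_conv_nn_integral_real[OF assms, symmetric])
  finally show "(\<integral>\<^sup>+w. ennreal (norm (indicator {0..x} w *\<^sub>R (exp (- w) * w powr (\<alpha> - 1)))) \<partial>lborel) < \<infinity>"
    by (simp add: le_less_trans)
qed measurable

text \<open>For \<alpha> < 1 the integrand is unbounded near 0. The fundamental theorem is therefore
  used in the form that asks for integrability on \<open>{0..x + 1}\<close> and continuity at
  \<open>x\<close> only.\<close>

lemma DERIV_lower_gamma:
  assumes \<alpha>: "0 < \<alpha>" and x: "0 < x"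
  shows "(lower_gamma \<alpha> has_real_derivative exp (- x) * x powr (\<alpha> - 1)) (at x)"
proof -
  let ?f = "\<lambda>w::real. exp (- w) * w powr (\<alpha> - 1)"
  have eq: "lower_gamma \<alpha> = (\<lambda>u. integral {0..u} ?f)"
    unfolding lower_gamma_def fun_eq_iff
    using set_borel_integral_eq_integral(2)[OF set_integrable_lower_gamma[OF \<alpha>]] by blast
  have "isCont ?f x" using x by (intro continuous_intros) auto
  then have "((\<lambda>u. integral {0..u} ?f) has_vector_derivative ?f x) (at x within ({0..x + 1} - {}))"
    using set_borel_integral_eq_integral(1)[OF set_integrable_lower_gamma[OF \<alpha>]] x
    by (intro integral_has_vector_derivative_continuous_at)
       (auto intro: continuous_at_imp_continuous_at_within)
  then have "((\<lambda>u. integral {0..u} ?f) has_vector_derivative ?f x) (at x within {0<..<x + 1})"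
    by (rule has_vector_derivative_within_subset) auto
  then show ?thesis
    using x by (simp add: eq has_real_derivative_iff_has_vector_derivative at_within_open[of x "{0<..<x + 1}"])
qed

lemma DERIV_phi_tempered:
  assumes "0 < \<alpha>" "0 < \<eta> + \<theta>"
  shows "(phi_tempered \<alpha> \<theta> has_real_derivative \<alpha> * (exp (- (\<eta> + \<theta>)) * (\<eta> + \<theta>) powr (\<alpha> - 1))) (at \<eta>)"
proof -
  have "((\<lambda>\<eta>. \<eta> + \<theta>) has_real_derivative 1) (at \<eta>)" by (auto intro!: derivative_eq_intros)
  from DERIV_chain2[OF DERIV_lower_gamma[OF assms] this] show ?thesis
    unfolding phi_tempered_def[abs_def] by (auto intro!: derivative_eq_intros)
qed

lemma phi_tempered_0[simp]: "phi_tempered \<alpha> \<theta> 0 = 0"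
  by (simp add: phi_tempered_def)

lemma phi_tempered_pos:
  assumes "0 < \<alpha>" "0 < \<theta>" "0 < \<eta>"
  shows "0 < phi_tempered \<alpha> \<theta> \<eta>"
proof -
  have "phi_tempered \<alpha> \<theta> 0 < phi_tempered \<alpha> \<theta> \<eta>"
  proof (rule DERIV_pos_imp_increasing[OF assms(3)])
    fix x assume "0 \<le> x" "x \<le> \<eta>"
    then show "\<exists>y. DERIV (phi_tempered \<alpha> \<theta>) x :> y \<and> 0 < y"
      using assms DERIV_phi_tempered[of \<alpha> x \<theta>]
      by (intro exI[of _ "\<alpha> * (exp (- (x + \<theta>)) * (x + \<theta>) powr (\<alpha> - 1))"]) auto
  qed
  then show ?thesis by simp
qed

section \<open>The exponent as an integral against the density\<close>

lemma nn_integral_phi_tempered: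
  assumes "0 < \<alpha>" "0 < \<theta>" "0 < \<eta>"
  shows "(\<integral>\<^sup>+w. ennreal (\<alpha> * (exp (- w) * w powr (\<alpha> - 1))) * indicator {\<theta>..\<theta> + \<eta>} w \<partial>lborel) =
    ennreal (phi_tempered \<alpha> \<theta> \<eta>)"
proof -
  have "(\<integral>\<^sup>+w. ennreal (\<alpha> * (exp (- w) * w powr (\<alpha> - 1))) * indicator {\<theta>..\<theta> + \<eta>} w \<partial>lborel) =
    ennreal (\<alpha> * lower_gamma \<alpha> (\<theta> + \<eta>) - \<alpha> * lower_gamma \<alpha> \<theta>)"
  proof (rule nn_integral_FTC_Icc)
    fix x assume "x \<in> {\<theta>..\<theta> + \<eta>}"
    then show "DERIV (\<lambda>x. \<alpha> * lower_gamma \<alpha> x) x :> \<alpha> * (exp (- x) * x powr (\<alpha> - 1))"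
      using assms by (intro DERIV_cmult DERIV_lower_gamma) auto
  qed (use assms in auto)
  then show ?thesis by (simp add: phi_tempered_def add.commute)
qed

text \<open>The substitution z = 1 + x / w reduces this to the Gamma integral: the shift produces
  \<open>exp (- w)\<close> and the scaling produces \<open>w powr (\<alpha> - 1)\<close>.\<close>

lemma nn_integral_shifted_gamma:
  assumes "\<alpha> < 1" "0 < w"
  shows "(\<integral>\<^sup>+z. ennreal (indicator {1..} z * (z - 1) powr (- \<alpha>) * exp (- w * z)) \<partial>lborel) =
    ennreal (Gamma (1 - \<alpha>) * (exp (- w) * w powr (\<alpha> - 1)))"
proof -
  have "(\<integral>\<^sup>+z. ennreal (indicator {1..} z * (z - 1) powr (- \<alpha>) * exp (- w * z)) \<partial>lborel) =
    ennreal (1 / w) * (\<integral>\<^sup>+x. ennreal (indicator {1..} (1 + 1 / w * x) * (1 + 1 / w * x - 1) powr (- \<alpha>) *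
      exp (- w * (1 + 1 / w * x))) \<partial>lborel)"
    using assms by (subst nn_integral_real_affine[where c = "1 / w" and t = 1]) auto
  also have "(\<integral>\<^sup>+x. ennreal (indicator {1..} (1 + 1 / w * x) * (1 + 1 / w * x - 1) powr (- \<alpha>) *
      exp (- w * (1 + 1 / w * x))) \<partial>lborel) =
    (\<integral>\<^sup>+x. ennreal (w powr \<alpha> * exp (- w)) * ennreal (indicator {0..} x * x powr ((1 - \<alpha>) - 1) / exp x) \<partial>lborel)"
  proof (intro nn_integral_cong)
    fix x :: real
    have *: "indicator {1..} (1 + 1 / w * x) * (1 + 1 / w * x - 1) powr (- \<alpha>) * exp (- w * (1 + 1 / w * x)) =
      (w powr \<alpha> * exp (- w)) * (indicator {0..} x * x powr ((1 - \<alpha>) - 1) / exp x)"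
    proof (cases "0 \<le> x")
      case True
      have "(x / w) powr (- \<alpha>) = w powr \<alpha> * x powr (- \<alpha>)"
        using True assms by (simp add: powr_divide powr_minus field_simps)
      moreover have "exp (- w * (1 + 1 / w * x)) = exp (- w) / exp x"
        using assms by (simp add: distrib_left exp_add[symmetric] exp_diff[symmetric])
      ultimately show ?thesis using True assms by simp
    next
      case False
      then have "\<not> 1 \<le> 1 + 1 / w * x" using assms by (simp add: zero_le_divide_iff)
      then show ?thesis using False by simp
    qed
    show "ennreal (indicator {1..} (1 + 1 / w * x) * (1 + 1 / w * x - 1) powr (- \<alpha>) *
      exp (- w * (1 + 1 / w * x))) =
      ennreal (w powr \<alpha> * exp (- w)) * ennreal (indicator {0..} x * x powr ((1 - \<alpha>) - 1) / exp x)"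
      unfolding * by (rule ennreal_mult) auto
  qed
  also have "\<dots> = ennreal (w powr \<alpha> * exp (- w)) * ennreal (Gamma (1 - \<alpha>))"
    using assms by (subst nn_integral_cmult) (auto simp: Gamma_conv_nn_integral_real)
  also have "ennreal (1 / w) * (ennreal (w powr \<alpha> * exp (- w)) * ennreal (Gamma (1 - \<alpha>))) =
    ennreal (Gamma (1 - \<alpha>) * (exp (- w) * w powr (\<alpha> - 1)))"
    using assms Gamma_real_pos[of "1 - \<alpha>"]
    by (simp add: ennreal_mult[symmetric] powr_diff mult_ac)
  finally show ?thesis .
qed

lemma pi_density_nonneg:
  assumes "0 < \<alpha>" "\<alpha> < 1"
  shows "0 \<le> pi_density \<alpha> \<theta> z"
  using assms Gamma_real_pos[of "1 - \<alpha>"] by (auto simp: pi_density_def indicator_def)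

lemma pi_density_measurable[measurable]: "pi_density \<alpha> \<theta> \<in> borel_measurable borel"
  unfolding pi_density_def[abs_def] by measurable

text \<open>Tonelli, starting from
  \<open>(1 - exp (- \<eta> z)) exp (- \<theta> z) / z = \<integral> exp (- w z) dw\<close> over \<open>{\<theta>..\<theta> + \<eta>}\<close>.\<close>

lemma nn_integral_pi_density:
  assumes \<alpha>: "0 < \<alpha>" "\<alpha> < 1" and \<theta>: "0 < \<theta>" and \<eta>: "0 < \<eta>"
  shows "(\<integral>\<^sup>+z. ennreal (pi_density \<alpha> \<theta> z) * ennreal (1 - exp (- z * \<eta>)) \<partial>lborel) =
    ennreal (phi_tempered \<alpha> \<theta> \<eta>)"
proof -
  have G: "0 < Gamma (1 - \<alpha>)" using \<alpha> by (intro Gamma_real_pos) auto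
  \<comment> \<open>The factors 1/z and exp(-\<theta> z) of the density are left out of
    \<open>k\<close>; they emerge from the integral over \<open>w\<close>.\<close>
  define k where "k z = indicator {1..} z * (z - 1) powr (- \<alpha>)" for z :: real
  have k0: "0 \<le> k z" for z by (simp add: k_def)
  have [measurable]: "k \<in> borel_measurable borel" unfolding k_def[abs_def] by measurable
  have inner: "ennreal (pi_density \<alpha> \<theta> z) * ennreal (1 - exp (- z * \<eta>)) =
    (\<integral>\<^sup>+w. ennreal (\<alpha> / Gamma (1 - \<alpha>)) * ennreal (k z * exp (- w * z)) * indicator {\<theta>..\<theta> + \<eta>} w \<partial>lborel)" for z
  proof (cases "1 \<le> z")
    case True
    then have z: "0 < z" by simp
    have "(\<integral>\<^sup>+w. ennreal (exp (- w * z)) * indicator {\<theta>..\<theta> + \<eta>} w \<partial>lborel) =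
      ennreal (- exp (- (\<theta> + \<eta>) * z) / z - (- exp (- \<theta> * z) / z))"
    proof (rule nn_integral_FTC_Icc)
      show "DERIV (\<lambda>w. - exp (- w * z) / z) w :> exp (- w * z)" for w
        using z by (auto intro!: derivative_eq_intros)
    qed (use \<eta> in auto)
    also have "- exp (- (\<theta> + \<eta>) * z) / z - (- exp (- \<theta> * z) / z) = exp (- \<theta> * z) / z * (1 - exp (- z * \<eta>))"
      using z by (simp add: field_simps exp_add[symmetric])
    finally have I: "(\<integral>\<^sup>+w. ennreal (exp (- w * z)) * indicator {\<theta>..\<theta> + \<eta>} w \<partial>lborel) =
      ennreal (exp (- \<theta> * z) / z * (1 - exp (- z * \<eta>)))" .
    have "(\<integral>\<^sup>+w. ennreal (\<alpha> / Gamma (1 - \<alpha>)) * ennreal (k z * exp (- w * z)) * indicator {\<theta>..\<theta> + \<eta>} w \<partial>lborel) =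
      (\<integral>\<^sup>+w. ennreal (\<alpha> / Gamma (1 - \<alpha>) * k z) * (ennreal (exp (- w * z)) * indicator {\<theta>..\<theta> + \<eta>} w) \<partial>lborel)"
    proof -
      have "ennreal (k z * exp (- w * z)) = ennreal (k z) * ennreal (exp (- w * z))" for w
        by (rule ennreal_mult) (auto simp: k0)
      moreover have "ennreal (\<alpha> / Gamma (1 - \<alpha>) * k z) = ennreal (\<alpha> / Gamma (1 - \<alpha>)) * ennreal (k z)"
        using \<alpha> G by (intro ennreal_mult) (auto simp: k0)
      ultimately show ?thesis by (simp only: mult_ac)
    qed
    also have "\<dots> = ennreal (\<alpha> / Gamma (1 - \<alpha>) * k z) * ennreal (exp (- \<theta> * z) / z * (1 - exp (- z * \<eta>)))"
      by (subst nn_integral_cmult, simp, simp only: I)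
    also have "\<dots> = ennreal (\<alpha> / Gamma (1 - \<alpha>) * k z * (exp (- \<theta> * z) / z * (1 - exp (- z * \<eta>))))"
      using \<alpha> G k0[of z] z \<eta> by (intro ennreal_mult[symmetric]) auto
    also have "\<alpha> / Gamma (1 - \<alpha>) * k z * (exp (- \<theta> * z) / z * (1 - exp (- z * \<eta>))) =
       pi_density \<alpha> \<theta> z * (1 - exp (- z * \<eta>))"
      using z by (simp add: k_def pi_density_def powr_minus_divide mult_ac)
    finally show ?thesis
      using pi_density_nonneg[OF \<alpha>] z \<eta> by (simp add: ennreal_mult)
  next
    case False
    then show ?thesis by (simp add: k_def pi_density_def)
  qed
  have "(\<integral>\<^sup>+z. ennreal (pi_density \<alpha> \<theta> z) * ennreal (1 - exp (- z * \<eta>)) \<partial>lborel) =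
    (\<integral>\<^sup>+z. \<integral>\<^sup>+w. ennreal (\<alpha> / Gamma (1 - \<alpha>)) * ennreal (k z * exp (- w * z)) * indicator {\<theta>..\<theta> + \<eta>} w \<partial>lborel \<partial>lborel)"
    by (simp only: inner)
  also have "\<dots> = (\<integral>\<^sup>+w. \<integral>\<^sup>+z. ennreal (\<alpha> / Gamma (1 - \<alpha>)) * ennreal (k z * exp (- w * z)) * indicator {\<theta>..\<theta> + \<eta>} w \<partial>lborel \<partial>lborel)"
    by (rule lborel_pair.Fubini') measurable
  also have "\<dots> = (\<integral>\<^sup>+w. ennreal (\<alpha> * (exp (- w) * w powr (\<alpha> - 1))) * indicator {\<theta>..\<theta> + \<eta>} w \<partial>lborel)"
  proof (intro nn_integral_cong)
    fix w
    show "(\<integral>\<^sup>+z. ennreal (\<alpha> / Gamma (1 - \<alpha>)) * ennreal (k z * exp (- w * z)) * indicator {\<theta>..\<theta> + \<eta>} w \<partial>lborel) =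
      ennreal (\<alpha> * (exp (- w) * w powr (\<alpha> - 1))) * indicator {\<theta>..\<theta> + \<eta>} w"
    proof (cases "w \<in> {\<theta>..\<theta> + \<eta>}")
      case True
      then have "0 < w" using \<theta> by auto
      then have "(\<integral>\<^sup>+z. ennreal (\<alpha> / Gamma (1 - \<alpha>)) * ennreal (k z * exp (- w * z)) \<partial>lborel) =
        ennreal (\<alpha> / Gamma (1 - \<alpha>)) * ennreal (Gamma (1 - \<alpha>) * (exp (- w) * w powr (\<alpha> - 1)))"
        using nn_integral_shifted_gamma[OF \<alpha>(2), of w]
        by (subst nn_integral_cmult) (auto simp: k_def)
      also have "\<dots> = ennreal (\<alpha> * (exp (- w) * w powr (\<alpha> - 1)))"
        using \<alpha> G by (subst ennreal_mult[symmetric]) (simp_all add: less_imp_neq[OF G, symmetric])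
      finally show ?thesis using True by simp
    qed simp
  qed
  also have "\<dots> = ennreal (phi_tempered \<alpha> \<theta> \<eta>)"
    by (rule nn_integral_phi_tempered[OF \<alpha>(1) \<theta> \<eta>])
  finally show ?thesis .
qed

text \<open>Dropping \<open>z powr (- 1)\<close>, which is at most 1 on the support, leaves the
  shifted Gamma integral at w = \<theta>, finite because \<theta> > 0 and \<alpha> < 1.\<close>

lemma nn_integral_pi_density_finite:
  assumes \<alpha>: "0 < \<alpha>" "\<alpha> < 1" and \<theta>: "0 < \<theta>"
  shows "(\<integral>\<^sup>+z. ennreal (pi_density \<alpha> \<theta> z) \<partial>lborel) < \<infinity>"
proof -
  have G: "0 < Gamma (1 - \<alpha>)" using \<alpha> by (intro Gamma_real_pos) auto
  have "(\<integral>\<^sup>+z. ennreal (pi_density \<alpha> \<theta> z) \<partial>lborel) \<le>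
    (\<integral>\<^sup>+z. ennreal (\<alpha> / Gamma (1 - \<alpha>)) * ennreal (indicator {1..} z * (z - 1) powr (- \<alpha>) * exp (- \<theta> * z)) \<partial>lborel)"
  proof (intro nn_integral_mono)
    fix z :: real
    have "pi_density \<alpha> \<theta> z \<le> \<alpha> / Gamma (1 - \<alpha>) * (indicator {1..} z * (z - 1) powr (- \<alpha>) * exp (- \<theta> * z))"
    proof (cases "1 \<le> z")
      case True
      have "(z - 1) powr (- \<alpha>) * exp (- \<theta> * z) * z powr (- 1) \<le> (z - 1) powr (- \<alpha>) * exp (- \<theta> * z) * 1"
        using True by (intro mult_left_mono) (auto simp: powr_minus_divide)
      then have "\<alpha> / Gamma (1 - \<alpha>) * ((z - 1) powr (- \<alpha>) * exp (- \<theta> * z) * z powr (- 1)) \<le>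
        \<alpha> / Gamma (1 - \<alpha>) * ((z - 1) powr (- \<alpha>) * exp (- \<theta> * z) * 1)"
        by (rule mult_left_mono) (use \<alpha> G in simp)
      moreover have "indicator {1..} z = (1 :: real)" using True by simp
      ultimately show ?thesis
        by (simp only: pi_density_def mult_1_left mult_1_right times_divide_eq_left times_divide_eq_right mult_ac)
    qed (simp add: pi_density_def)
    then show "ennreal (pi_density \<alpha> \<theta> z) \<le> ennreal (\<alpha> / Gamma (1 - \<alpha>)) *
       ennreal (indicator {1..} z * (z - 1) powr (- \<alpha>) * exp (- \<theta> * z))"
      using \<alpha> G by (subst ennreal_mult[symmetric]) (auto intro!: ennreal_leI)
  qed
  also have "\<dots> < \<infinity>"
    using nn_integral_shifted_gamma[OF \<alpha>(2) \<theta>]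
    by (subst nn_integral_cmult) (auto simp: ennreal_mult_less_top)
  finally show ?thesis .
qed

text \<open>Both regimes are put into one measure so that the later arguments need not distinguish
  them. At \<alpha> = 1 the density formula would give the zero measure, while the exponent calls
  for unit jumps at rate exp(-\<theta>).\<close>

definition tempered_levy_measure :: "real \<Rightarrow> real \<Rightarrow> real measure" where
  "tempered_levy_measure \<alpha> \<theta> =
     (if \<alpha> < 1 then density lborel (\<lambda>z. ennreal (pi_density \<alpha> \<theta> z))
      else scale_measure (ennreal (exp (- \<theta>))) (return borel 1))"

section \<open>The measure \<open>tempered_levy_measure\<close> and its integrals\<close>

context
  fixes \<alpha> \<theta> :: real
  assumes \<theta>: "0 < \<theta>" and \<alpha>: "0 < \<alpha>" "\<alpha> \<le> 1"
begin

lemma sets_tempered_levy_measure[measurable_cong]: "sets (tempered_levy_measure \<alpha> \<theta>) = sets borel"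
  by (simp add: tempered_levy_measure_def)

lemma nn_integral_tempered_levy_measure:
  assumes "0 < \<eta>"
  shows "(\<integral>\<^sup>+z. ennreal (1 - exp (- z * \<eta>)) \<partial>tempered_levy_measure \<alpha> \<theta>) = ennreal (phi_tempered \<alpha> \<theta> \<eta>)"
proof (cases "\<alpha> < 1")
  case True
  then show ?thesis
    using nn_integral_pi_density[OF \<alpha>(1) True \<theta> assms]
    by (simp add: tempered_levy_measure_def nn_integral_density)
next
  case False
  then have a: "\<alpha> = 1" using \<alpha> by simp
  have "(\<integral>\<^sup>+w. ennreal (exp (- w)) * indicator {\<theta>..\<theta> + \<eta>} w \<partial>lborel) =
      ennreal (- exp (- (\<theta> + \<eta>)) - (- exp (- \<theta>)))"
  proof (rule nn_integral_FTC_Icc)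
    show "DERIV (\<lambda>w. - exp (- w)) w :> exp (- w)" for w :: real
      by (auto intro!: derivative_eq_intros)
  qed (use assms in auto)
  \<comment> \<open>\<open>w powr 0\<close> equals 1 only for nonzero \<open>w\<close>; here
    \<open>w\<close> is at least \<theta> > 0.\<close>
  moreover have "(\<integral>\<^sup>+w. ennreal (1 * (exp (- w) * w powr (1 - 1))) * indicator {\<theta>..\<theta> + \<eta>} w \<partial>lborel) =
    (\<integral>\<^sup>+w. ennreal (exp (- w)) * indicator {\<theta>..\<theta> + \<eta>} w \<partial>lborel)"
    using \<theta> by (intro nn_integral_cong) (auto simp: indicator_def)
  moreover have "- exp (- (\<theta> + \<eta>)) - (- exp (- \<theta>)) = exp (- \<theta>) * (1 - exp (- \<eta>))"
    by (simp add: right_diff_distrib exp_add[symmetric])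
  ultimately have "ennreal (phi_tempered 1 \<theta> \<eta>) = ennreal (exp (- \<theta>)) * ennreal (1 - exp (- \<eta>))"
    using nn_integral_phi_tempered[of 1 \<theta> \<eta>] \<theta> assms by (simp add: ennreal_mult)
  then show ?thesis
    by (simp add: tempered_levy_measure_def a nn_integral_scale_measure nn_integral_return)
qed

lemma AE_tempered_levy_measure: "AE z in tempered_levy_measure \<alpha> \<theta>. 1 \<le> z"
proof (cases "\<alpha> < 1")
  case True
  then show ?thesis unfolding tempered_levy_measure_def
    by (simp, subst AE_density) (auto intro!: AE_I2 simp: pi_density_def indicator_def split: if_splits)
next
  case False
  have "{z :: real. \<not> 1 \<le> z} \<in> null_sets (scale_measure (ennreal (exp (- \<theta>))) (return borel 1))"
    by (intro null_setsI) (auto simp: emeasure_return)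
  then show ?thesis using False unfolding tempered_levy_measure_def
    by (auto dest: AE_not_in)
qed

lemma finite_tempered_levy_measure: "finite_measure (tempered_levy_measure \<alpha> \<theta>)"
proof (rule finite_measureI)
  show "emeasure (tempered_levy_measure \<alpha> \<theta>) (space (tempered_levy_measure \<alpha> \<theta>)) \<noteq> \<infinity>"
  proof (cases "\<alpha> < 1")
    case True
    then show ?thesis
      using nn_integral_pi_density_finite[OF \<alpha>(1) True \<theta>]
      by (simp add: tempered_levy_measure_def emeasure_density)
  next
    case False
    then show ?thesis
      by (simp add: tempered_levy_measure_def space_scale_measure emeasure_return ennreal_mult_eq_top_iff)
  qed
qed

lemma integral_tempered_levy_measure:
  assumes "0 < \<eta>"
  shows "(LINT z|tempered_levy_measure \<alpha> \<theta>. 1 - exp (- z * \<eta>)) = phi_tempered \<alpha> \<theta> \<eta>"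
proof (subst integral_eq_nn_integral)
  show "AE z in tempered_levy_measure \<alpha> \<theta>. 0 \<le> 1 - exp (- z * \<eta>)"
    using AE_tempered_levy_measure by eventually_elim (use assms in simp)
  show "enn2real (\<integral>\<^sup>+z. ennreal (1 - exp (- z * \<eta>)) \<partial>tempered_levy_measure \<alpha> \<theta>) = phi_tempered \<alpha> \<theta> \<eta>"
    using phi_tempered_pos[OF \<alpha>(1) \<theta> assms] by (simp only: nn_integral_tempered_levy_measure[OF assms]) simp
qed (simp cong: measurable_cong_sets add: sets_tempered_levy_measure)

text \<open>A null measure would force the exponent to vanish, but it is positive at 1. This permits
  the normalisation in the compound Poisson construction.\<close>

lemma emeasure_tempered_levy_measure_nonzero: "emeasure (tempered_levy_measure \<alpha> \<theta>) UNIV \<noteq> 0"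
proof
  assume "emeasure (tempered_levy_measure \<alpha> \<theta>) UNIV = 0"
  then have "AE z in tempered_levy_measure \<alpha> \<theta>. False"
    by (intro AE_I[where N = UNIV]) (auto simp: sets_tempered_levy_measure)
  then have "(LINT z|tempered_levy_measure \<alpha> \<theta>. 1 - exp (- z * 1)) = 0"
    by (intro integral_eq_zero_AE) (auto elim: eventually_mono)
  then show False
    using integral_tempered_levy_measure[of 1] phi_tempered_pos[OF \<alpha>(1) \<theta>, of 1] by simp
qed

lemma levy_triplet_tempered:
  "levy_triplet (phi_tempered \<alpha> \<theta>) 0 0 (tempered_levy_measure \<alpha> \<theta>)"
proof -
  interpret finite_measure "tempered_levy_measure \<alpha> \<theta>" by (rule finite_tempered_levy_measure)
  have "AE z in tempered_levy_measure \<alpha> \<theta>. z \<notin> {..0}"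
    using AE_tempered_levy_measure by eventually_elim simp
  then have "{..0} \<in> null_sets (tempered_levy_measure \<alpha> \<theta>)"
    by (subst AE_iff_null_sets) (auto simp: sets_tempered_levy_measure)
  moreover have "(\<integral>\<^sup>+ s. ennreal (min s 1) \<partial>tempered_levy_measure \<alpha> \<theta>) < \<infinity>"
  proof -
    have "(\<integral>\<^sup>+ s. ennreal (min s 1) \<partial>tempered_levy_measure \<alpha> \<theta>) \<le> (\<integral>\<^sup>+ s. 1 \<partial>tempered_levy_measure \<alpha> \<theta>)"
      by (intro nn_integral_mono) (auto simp: ennreal_le_1)
    also have "\<dots> < \<infinity>" by (simp add: less_top[symmetric])
    finally show ?thesis .
  qed
  ultimately show ?thesis
    by (auto simp: levy_triplet_def levy_measure_def sets_tempered_levy_measure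
        integral_tempered_levy_measure[simplified])
qed

text \<open>The bound is the total jump rate, because \<open>1 - exp (- z * \<eta>)\<close> is at
  most 1. It serves as the constant in \<open>subordinator_not_strict_mono\<close>.\<close>

lemma phi_tempered_bounded:
  assumes "0 < \<eta>"
  shows "phi_tempered \<alpha> \<theta> \<eta> \<le> measure (tempered_levy_measure \<alpha> \<theta>) UNIV"
proof -
  interpret finite_measure "tempered_levy_measure \<alpha> \<theta>" by (rule finite_tempered_levy_measure)
  have sp: "space (tempered_levy_measure \<alpha> \<theta>) = UNIV"
    using sets_eq_imp_space_eq[OF sets_tempered_levy_measure] by simp
  have "ennreal (phi_tempered \<alpha> \<theta> \<eta>) \<le> (\<integral>\<^sup>+z. 1 \<partial>tempered_levy_measure \<alpha> \<theta>)"
    unfolding nn_integral_tempered_levy_measure[OF assms, symmetric]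
    by (intro nn_integral_mono) (auto simp: ennreal_le_1)
  also have "\<dots> = ennreal (measure (tempered_levy_measure \<alpha> \<theta>) UNIV)"
    by (simp add: sp emeasure_eq_measure)
  finally show ?thesis by (simp add: ennreal_le_iff)
qed

end

text \<open>With F(x) = exp(-t \<phi>(x)), the mean is -F'(0) and the second moment is
  F''(0).\<close>

lemma tempered_subordinator_moments:
  assumes \<theta>: "0 < \<theta>" and \<alpha>: "0 < \<alpha>" and t: "0 \<le> t"
    and S: "subordinator M S" and L: "has_laplace_exponent M S (phi_tempered \<alpha> \<theta>)"
  shows "integrable M (S t)" and "integrable M (\<lambda>\<omega>. (S t \<omega>)\<^sup>2)"
    and "prob_space.expectation M (S t) = t * \<alpha> * \<theta> powr (\<alpha> - 1) * exp (- \<theta>)"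
    and "prob_space.variance M (S t) = t * \<alpha> * \<theta> powr (\<alpha> - 1) * exp (- \<theta>) +
      \<alpha> * (1 - \<alpha>) * t * \<theta> powr (\<alpha> - 2) * exp (- \<theta>)"
proof -
  interpret prob_space M using S by (simp add: subordinator_def levy_process_def)
  have rv: "random_variable borel (S t)" using S t by (simp add: subordinator_def levy_process_def)
  define g where "g x = \<alpha> * (exp (- (x + \<theta>)) * (x + \<theta>) powr (\<alpha> - 1))" for x
  define F where "F x = exp (- t * phi_tempered \<alpha> \<theta> x)" for x
  define F' where "F' x = - t * g x * F x" for x
  \<comment> \<open>Since \<open>g\<close> is the derivative of the exponent, F''(0) = (t g(0))^2 -
    t g'(0), and logarithmic differentiation gives g'(0) = -g(0) (1 + (1 - \<alpha>) / \<theta>).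
    The square cancels in the variance.\<close>
  define D where "D = (t * g 0)\<^sup>2 + t * g 0 * (1 + (1 - \<alpha>) / \<theta>)"
  have F0: "F 0 = 1" by (simp add: F_def)
  \<comment> \<open>The tempering makes the formula for the exponent smooth on both sides of 0. For
    negative x it is only a formula, with no claim about an expectation.\<close>
  have dF: "(F has_real_derivative F' x) (at x)" if "\<bar>x\<bar> < \<theta>" for x
    unfolding F_def[abs_def] F'_def g_def
    using DERIV_phi_tempered[OF \<alpha>, of x \<theta>] that by (auto intro!: derivative_eq_intros)
  have dg: "(g has_real_derivative - g 0 * (1 + (1 - \<alpha>) / \<theta>)) (at 0)"
  proof -
    have sh: "((\<lambda>x. x + \<theta>) has_real_derivative 1) (at 0)" by (auto intro!: derivative_eq_intros)
    have "((\<lambda>z. z powr (\<alpha> - 1)) has_real_derivative (\<alpha> - 1) * \<theta> powr (\<alpha> - 1 - 1)) (at (0 + \<theta>))"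
      unfolding add_0 by (rule has_real_derivative_powr[OF \<theta>])
    note p = DERIV_chain2[OF this sh]
    have pow: "\<theta> powr (\<alpha> - 1 - 1) = \<theta> powr (\<alpha> - 1) / \<theta>"
      using \<theta> powr_diff[of \<theta> "\<alpha> - 1" 1] by (simp only: powr_one)
    have e: "((\<lambda>x. exp (- (x + \<theta>))) has_real_derivative - exp (- \<theta>)) (at 0)"
      by (auto intro!: derivative_eq_intros)
    have "\<alpha> * (- exp (- \<theta>) * (0 + \<theta>) powr (\<alpha> - 1) + (\<alpha> - 1) * \<theta> powr (\<alpha> - 1 - 1) * 1 * exp (- (0 + \<theta>))) =
      - g 0 * (1 + (1 - \<alpha>) / \<theta>)"
      unfolding pow g_def using \<theta> by (simp only: add_0) (simp add: field_simps del: powr_diff)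
    with DERIV_cmult[OF DERIV_mult[OF e p], of \<alpha>] show ?thesis
      unfolding g_def[abs_def] by simp
  qed
  have dF': "(F' has_real_derivative D) (at 0)"
  proof -
    have "- t * (- g 0 * (1 + (1 - \<alpha>) / \<theta>)) * F 0 + F' 0 * (- t * g 0) = D"
      by (simp add: D_def F'_def F0 power2_eq_square)
    with DERIV_mult[OF DERIV_cmult[OF dg, of "- t"] dF[of 0]] \<theta> show ?thesis
      unfolding F'_def[abs_def] by simp
  qed
  have "((\<lambda>x. (F x - 1) / x) \<longlongrightarrow> F' 0) (at 0)"
    using dF[of 0] \<theta> F0 by (simp add: DERIV_def)
  then have "((\<lambda>x. - ((F x - 1) / x)) \<longlongrightarrow> - F' 0) (at_right 0)"
    by (intro tendsto_minus) (auto intro: filterlim_mono at_le)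
  then have m: "((\<lambda>x. (1 - F x) / x) \<longlongrightarrow> t * g 0) (at_right 0)"
    by (simp add: F'_def F0 minus_divide_left)
  have v: "((\<lambda>x. (1 - 2 * F x + F (2 * x)) / x\<^sup>2) \<longlongrightarrow> D) (at_right 0)"
    using second_difference_tendsto[OF \<theta> dF dF'] by (simp add: F0)
  have LF: "expectation (\<lambda>\<omega>. exp (- \<eta> * S t \<omega>)) = F \<eta>" if "0 < \<eta>" for \<eta>
    using L t that by (simp add: has_laplace_exponent_def F_def)
  have mom: "integrable M (S t)" "expectation (S t) = t * g 0"
    "integrable M (\<lambda>\<omega>. (S t \<omega>)\<^sup>2)" "expectation (\<lambda>\<omega>. (S t \<omega>)\<^sup>2) = D"
    by (rule moments_of_laplace_transform[OF rv subordinator_nonneg[OF S t] _ m v], erule LF)+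
  show "integrable M (S t)" "integrable M (\<lambda>\<omega>. (S t \<omega>)\<^sup>2)" using mom(1) mom(3) by simp_all
  have g0: "g 0 = \<alpha> * \<theta> powr (\<alpha> - 1) * exp (- \<theta>)" by (simp add: g_def)
  show "expectation (S t) = t * \<alpha> * \<theta> powr (\<alpha> - 1) * exp (- \<theta>)"
    by (simp add: mom g0)
  have pow: "\<theta> powr (\<alpha> - 2) = \<theta> powr (\<alpha> - 1) / \<theta>"
    using \<theta> powr_diff[of \<theta> "\<alpha> - 1" 1] by simp
  have "variance (S t) = D - (t * g 0)\<^sup>2"
    using variance_eq[OF mom(1) mom(3)] unfolding mom(2) mom(4) .
  also have "\<dots> = t * g 0 * (1 + (1 - \<alpha>) / \<theta>)" by (simp add: D_def)
  also have "\<dots> = t * \<alpha> * \<theta> powr (\<alpha> - 1) * exp (- \<theta>) +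
      \<alpha> * (1 - \<alpha>) * t * \<theta> powr (\<alpha> - 2) * exp (- \<theta>)"
    unfolding pow g0 using \<theta> by (simp add: field_simps)
  finally show "variance (S t) = t * \<alpha> * \<theta> powr (\<alpha> - 1) * exp (- \<theta>) +
      \<alpha> * (1 - \<alpha>) * t * \<theta> powr (\<alpha> - 2) * exp (- \<theta>)" .
qed

(* The existential ranges over probability spaces on real sequences: HOL cannot quantify over
   types, and such a space carries every process considered here.  The final conjunct is
   about every process with this exponent, over an arbitrary sample space 'w.
   The Levy measure has the stated density for alpha < 1; at the endpoint alpha = 1, where
   the exponent equals exp (-theta) * (1 - exp (-eta)), it is an atom at 1 (Poisson process),
   the weak limit of the measures for alpha < 1. *)
theorem theorem6:
  fixes \<alpha> \<theta> :: real
  assumes "0 < \<theta>" and "0 < \<alpha>" and "\<alpha> \<le> 1"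
  shows
    "(\<exists>(M :: (nat \<Rightarrow> real) measure) S.
        subordinator M S \<and> has_laplace_exponent M S (phi_tempered \<alpha> \<theta>)) \<and>
     (\<exists>\<pi>. levy_triplet (phi_tempered \<alpha> \<theta>) 0 0 \<pi> \<and>
        (\<alpha> < 1 \<longrightarrow> absolutely_continuous lborel \<pi> \<and>
                    \<pi> = density lborel (\<lambda>z. ennreal (pi_density \<alpha> \<theta> z))) \<and>
        (\<alpha> = 1 \<longrightarrow> \<pi> = scale_measure (ennreal (exp (- \<theta>))) (return borel 1))) \<and>
     (\<forall>(M :: 'w measure) S.
        subordinator M S \<and> has_laplace_exponent M S (phi_tempered \<alpha> \<theta>) \<longrightarrow>
          (AE \<omega> in M. \<not> strict_mono_on {0..} (\<lambda>t. S t \<omega>)) \<and>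
          (\<forall>t\<ge>0.
             integrable M (S t) \<and>
             integrable M (\<lambda>\<omega>. (S t \<omega>)\<^sup>2) \<and>
             prob_space.expectation M (S t) = t * \<alpha> * \<theta> powr (\<alpha> - 1) * exp (- \<theta>) \<and>
             prob_space.variance M (S t) =
               t * \<alpha> * \<theta> powr (\<alpha> - 1) * exp (- \<theta>) +
               \<alpha> * (1 - \<alpha>) * t * \<theta> powr (\<alpha> - 2) * exp (- \<theta>)))"
proof (intro conjI)
  have nonneg: "AE z in tempered_levy_measure \<alpha> \<theta>. 0 \<le> z"
    using AE_tempered_levy_measure[OF assms] by eventually_elim simp
  obtain M :: "(nat \<Rightarrow> real) measure" and S where "subordinator M S"
    and "has_laplace_exponent M S (\<lambda>\<eta>. LINT s|tempered_levy_measure \<alpha> \<theta>. 1 - exp (- s * \<eta>))"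
    using exists_compound_poisson_subordinator[OF finite_tempered_levy_measure[OF assms]
        sets_tempered_levy_measure[OF assms] emeasure_tempered_levy_measure_nonzero[OF assms] nonneg]
    by blast
  then show "\<exists>(M :: (nat \<Rightarrow> real) measure) S.
      subordinator M S \<and> has_laplace_exponent M S (phi_tempered \<alpha> \<theta>)"
    by (intro exI[of _ M] exI[of _ S])
       (simp add: has_laplace_exponent_def integral_tempered_levy_measure[OF assms, simplified])
next
  show "\<exists>\<pi>. levy_triplet (phi_tempered \<alpha> \<theta>) 0 0 \<pi> \<and>
        (\<alpha> < 1 \<longrightarrow> absolutely_continuous lborel \<pi> \<and>
                    \<pi> = density lborel (\<lambda>z. ennreal (pi_density \<alpha> \<theta> z))) \<and>
        (\<alpha> = 1 \<longrightarrow> \<pi> = scale_measure (ennreal (exp (- \<theta>))) (return borel 1))"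
    by (intro exI[of _ "tempered_levy_measure \<alpha> \<theta>"] conjI levy_triplet_tempered[OF assms])
       (auto simp: tempered_levy_measure_def intro!: absolutely_continuousI_density)
next
  show "\<forall>(M :: 'w measure) S.
        subordinator M S \<and> has_laplace_exponent M S (phi_tempered \<alpha> \<theta>) \<longrightarrow>
          (AE \<omega> in M. \<not> strict_mono_on {0..} (\<lambda>t. S t \<omega>)) \<and>
          (\<forall>t\<ge>0.
             integrable M (S t) \<and>
             integrable M (\<lambda>\<omega>. (S t \<omega>)\<^sup>2) \<and>
             prob_space.expectation M (S t) = t * \<alpha> * \<theta> powr (\<alpha> - 1) * exp (- \<theta>) \<and>
             prob_space.variance M (S t) =
               t * \<alpha> * \<theta> powr (\<alpha> - 1) * exp (- \<theta>) +
               \<alpha> * (1 - \<alpha>) * t * \<theta> powr (\<alpha> - 2) * exp (- \<theta>))"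
  proof (intro allI impI, elim conjE, intro conjI allI impI)
    fix M :: "'w measure" and S
    assume S: "subordinator M S" "has_laplace_exponent M S (phi_tempered \<alpha> \<theta>)"
    show "AE \<omega> in M. \<not> strict_mono_on {0..} (\<lambda>t. S t \<omega>)"
      by (rule subordinator_not_strict_mono[OF S phi_tempered_bounded[OF assms]])
    fix t :: real assume "0 \<le> t"
    note tempered_subordinator_moments[OF assms(1,2) this S]
    then show "integrable M (S t)" "integrable M (\<lambda>\<omega>. (S t \<omega>)\<^sup>2)"
      "prob_space.expectation M (S t) = t * \<alpha> * \<theta> powr (\<alpha> - 1) * exp (- \<theta>)"
      "prob_space.variance M (S t) = t * \<alpha> * \<theta> powr (\<alpha> - 1) * exp (- \<theta>) +
         \<alpha> * (1 - \<alpha>) * t * \<theta> powr (\<alpha> - 2) * exp (- \<theta>)"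
      by this
  qed
qed

end
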